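(* Let $n\geq 8$ and $1\leq g\leq n-1$. Then $c\kappa_{g+1}(FQ_n)=g(n+1)-\frac{1}{2}g(g+1)+1$.
   Context: The $n$-dimensional hypercube $Q_n$ has vertex set $\{0,1\}^n$, two vertices being adjacent iff their binary strings differ in exactly one position. The $n$-dimensional folded hypercube $FQ_n$ is obtained from $Q_n$ by adding the perfect matching $\{u\bar u : u\in V(Q_n)\}$, where $\bar u$ is the bitwise complement of $u$. For a non-complete connected graph $G$ and a positive integer $k$, a $k$-component cut is a vertex set whose deletion leaves a graph with at least $k$ components, and the $k$-component connectivity $c\kappa_k(G)$ is the minimum size of a $k$-component cut of $G$. *)

theory Defs
  imports Complex_Main "Graph_Theory.Graph_Theory"
begin

text \<open>
  Undirected graphs are symmetric digraphs: the edge \<open>uv\<close> is the pair of arcs \<open>(u, v)\<close>, \<open>(v, u)\<close>.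
\<close>

definition binary_strings :: "nat \<Rightarrow> bool list set" where
  "binary_strings n = {u. length u = n}"

definition hypercube :: "nat \<Rightarrow> bool list pair_pre_digraph" where
  "hypercube n = \<lparr> pverts = binary_strings n,
     parcs = {(u, v). u \<in> binary_strings n \<and> v \<in> binary_strings n
                \<and> card {i. i < n \<and> u ! i \<noteq> v ! i} = 1} \<rparr>"

definition bit_complement :: "bool list \<Rightarrow> bool list" where
  "bit_complement u = map Not u"

definition folded_hypercube :: "nat \<Rightarrow> bool list pair_pre_digraph" where
  "folded_hypercube n = \<lparr> pverts = pverts (hypercube n),
     parcs = parcs (hypercube n) \<union> {(u, bit_complement u) | u. u \<in> pverts (hypercube n)} \<rparr>"

lemma bit_complement_invol [simp]: "bit_complement (bit_complement u) = u"
  by (simp add: bit_complement_def comp_def)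

lemma bit_complement_neq: "u \<noteq> [] \<Longrightarrow> bit_complement u \<noteq> u"
  by (cases u) (auto simp: bit_complement_def)

lemma pair_graph_folded_hypercube:
  assumes "n \<ge> 1"
  shows "pair_graph (folded_hypercube n)"
proof -
  let ?G = "folded_hypercube n"
  have fin: "finite (pverts ?G)"
    using finite_lists_length_eq[of "UNIV :: bool set" n]
    by (simp add: folded_hypercube_def hypercube_def binary_strings_def)
  have wf: "parcs ?G \<subseteq> pverts ?G \<times> pverts ?G"
    by (auto simp: folded_hypercube_def hypercube_def binary_strings_def bit_complement_def)
  have loop: "u \<noteq> v" if "(u, v) \<in> parcs ?G" for u v
    using that assms bit_complement_neq[of u]
    by (cases u) (auto simp: folded_hypercube_def hypercube_def binary_strings_def)
  have sym: "(v, u) \<in> parcs ?G" if "(u, v) \<in> parcs ?G" for u v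
  proof -
    have "{i. i < n \<and> v ! i \<noteq> u ! i} = {i. i < n \<and> u ! i \<noteq> v ! i}"
      by auto
    moreover have "length (bit_complement w) = length w" for w
      by (simp add: bit_complement_def)
    ultimately show ?thesis
      using that by (fastforce simp: folded_hypercube_def hypercube_def binary_strings_def)
  qed
  have "finite (parcs ?G)"
    using finite_subset[OF wf] fin by simp
  with fin wf loop sym show ?thesis
    by unfold_locales (auto simp: symmetric_def arcs_ends_def arc_to_ends_def intro!: symI)
qed

text \<open>
  The components of a symmetric digraph are its strongly connected components.
\<close>

definition component_cut :: "'a pair_pre_digraph \<Rightarrow> nat \<Rightarrow> 'a set \<Rightarrow> bool" where
  "component_cut G k S \<longleftrightarrow>
     S \<subseteq> pverts G \<and> k \<le> card (pre_digraph.sccs (with_proj G \<restriction> (pverts G - S)))"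

text \<open>
  Meaningful for finite non-complete connected \<open>G\<close> and positive \<open>k\<close> for which a
  \<open>k\<close>-component cut exists; otherwise the value is unspecified.
\<close>

definition component_connectivity :: "nat \<Rightarrow> 'a pair_pre_digraph \<Rightarrow> nat" where
  "component_connectivity k G = (LEAST s. \<exists>S. component_cut G k S \<and> card S = s)"

end

theory Submission
  imports Defs
begin

text \<open>
  Identify binary strings with subsets of \<open>{..<n}\<close> under symmetric difference: \<open>FQ\<^sub>n\<close> is a Cayley
  graph with \<open>n + 1\<close> generators, the singletons and the whole set. Deleting the neighbourhood of \<open>g\<close>
  neighbours of a single vertex isolates these \<open>g\<close> vertices, which gives the upper bound. For the
  lower bound, the components left by a cut \<open>S\<close> can be grouped into two mutually non-adjacent sides
  \<open>A\<close>, \<open>B\<close> with at least \<open>g\<close> vertices each.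

  If \<open>|A| = a \<le> n + 2\<close>, then the closed neighbourhoods of the vertices of \<open>A\<close> are \<open>(n + 2)\<close>-sets
  which pairwise meet in at most two points, and any three of which that meet pairwise have a common
  point; any such family covers at least \<open>a (n + 2) - a (a + 1) / 2 + 1\<close> points. If both sides have
  at least \<open>n + 3\<close> vertices, the edges of \<open>Q\<^sub>n\<close> alone force \<open>|S| \<ge> n (n + 1) / 2\<close>: this vertex
  isoperimetric inequality is proved by splitting the cube into two halves, starting from a
  computation in \<open>Q\<^sub>6\<close>.
\<close>

section \<open>Unions of set families with small intersections\<close>

locale helly_family =
  fixes A :: "'v set" and Nb :: "'v \<Rightarrow> 'w set"
  assumes finite_index: "finite A"
    and finite_Nb: "\<And>v. v \<in> A \<Longrightarrow> finite (Nb v)"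
    and meet_le_2: "\<And>x y. x \<in> A \<Longrightarrow> y \<in> A \<Longrightarrow> x \<noteq> y \<Longrightarrow> card (Nb x \<inter> Nb y) \<le> 2"
    and helly: "\<And>x y z. x \<in> A \<Longrightarrow> y \<in> A \<Longrightarrow> z \<in> A \<Longrightarrow> x \<noteq> y \<Longrightarrow> y \<noteq> z \<Longrightarrow> x \<noteq> z \<Longrightarrow>
      Nb x \<inter> Nb y \<noteq> {} \<Longrightarrow> Nb y \<inter> Nb z \<noteq> {} \<Longrightarrow> Nb x \<inter> Nb z \<noteq> {} \<Longrightarrow>
      Nb x \<inter> Nb y \<inter> Nb z \<noteq> {}"
begin

text \<open>The neighbours of \<open>v\<close> in the intersection graph of the family.\<close>

definition meeting :: "'v \<Rightarrow> 'v set" where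
  "meeting v = {y \<in> A. y \<noteq> v \<and> Nb v \<inter> Nb y \<noteq> {}}"

definition overlap :: "'v \<Rightarrow> 'v set \<Rightarrow> nat" where
  "overlap v X = card (Nb v \<inter> \<Union> (Nb ` X))"

text \<open>Unions of connected components of the intersection graph induced on
  \<open>meeting v\<close>; a minimal nonempty one is a single component.\<close>

definition meeting_closed :: "'v \<Rightarrow> 'v set \<Rightarrow> bool" where
  "meeting_closed v X \<longleftrightarrow> X \<subseteq> meeting v \<and> (\<forall>x\<in>X. meeting x \<inter> meeting v \<subseteq> X)"

lemma finite_meeting: "finite (meeting v)"
  using finite_index by (auto simp: meeting_def)

lemma meeting_sym: "y \<in> meeting x \<Longrightarrow> x \<in> A \<Longrightarrow> x \<in> meeting y"
  by (auto simp: meeting_def)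

lemma overlap_Un: "v \<in> A \<Longrightarrow> overlap v (X \<union> Y) \<le> overlap v X + overlap v Y"
proof -
  have "Nb v \<inter> \<Union> (Nb ` (X \<union> Y)) = (Nb v \<inter> \<Union> (Nb ` X)) \<union> (Nb v \<inter> \<Union> (Nb ` Y))" by auto
  then show ?thesis unfolding overlap_def by (metis card_Un_le)
qed

lemma overlap_singleton: "v \<in> A \<Longrightarrow> y \<in> meeting v \<Longrightarrow> overlap v {y} \<le> 2"
  using meet_le_2[of v y] by (auto simp: overlap_def meeting_def)

lemma overlap_eq_meeting: "overlap v (A - {v}) = overlap v (meeting v)"
proof -
  have "Nb v \<inter> \<Union> (Nb ` (A - {v})) = Nb v \<inter> \<Union> (Nb ` meeting v)" by (auto simp: meeting_def)
  then show ?thesis by (simp add: overlap_def)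
qed

lemma overlap_le_double:
  assumes "v \<in> A" "X \<subseteq> meeting v"
  shows "overlap v X \<le> 2 * card X"
proof -
  have "finite X" using assms finite_meeting finite_subset by blast
  then show ?thesis using assms(2)
  proof induction
    case empty then show ?case by (simp add: overlap_def)
  next
    case (insert x X)
    then show ?case
      using overlap_Un[OF assms(1), of "{x}" X] overlap_singleton[OF assms(1), of x] by simp
  qed
qed

text \<open>The Helly property gives a point common to all three sets. It is one of the at most two
  points shared by \<open>Nb v\<close> and \<open>Nb z\<close>, and it is already counted through
  \<open>y\<close>.\<close>

lemma overlap_insert_adjacent:
  assumes "v \<in> A" "y \<in> Y" "y \<in> meeting v" "z \<in> meeting v" "z \<in> meeting y"
  shows "overlap v (insert z Y) \<le> overlap v Y + 1"
proof -
  have "Nb v \<inter> Nb y \<inter> Nb z \<noteq> {}"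
    using assms by (intro helly) (auto simp: meeting_def)
  then obtain w where w: "w \<in> Nb v" "w \<in> Nb y" "w \<in> Nb z" by auto
  have fin: "finite (Nb v)" by (rule finite_Nb[OF assms(1)])
  have "Nb v \<inter> \<Union> (Nb ` insert z Y) \<subseteq> (Nb v \<inter> \<Union> (Nb ` Y)) \<union> (Nb v \<inter> Nb z - {w})"
    using w assms(2) by auto
  then have "overlap v (insert z Y) \<le> card ((Nb v \<inter> \<Union> (Nb ` Y)) \<union> (Nb v \<inter> Nb z - {w}))"
    unfolding overlap_def using fin by (intro card_mono) auto
  also have "\<dots> \<le> overlap v Y + card (Nb v \<inter> Nb z - {w})"
    unfolding overlap_def by (rule card_Un_le)
  also have "card (Nb v \<inter> Nb z - {w}) \<le> 1"
    using meet_le_2[of v z] assms w fin by (auto simp: meeting_def)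
  finally show ?thesis by simp
qed

text \<open>By the Helly property every further member of a component contributes only one new point.\<close>

lemma overlap_component:
  assumes v: "v \<in> A" and C: "meeting_closed v C" "C \<noteq> {}"
    and minimal: "\<And>X. meeting_closed v X \<Longrightarrow> X \<noteq> {} \<Longrightarrow> X \<subseteq> C \<Longrightarrow> X = C"
  shows "overlap v C \<le> card C + 1"
proof -
  define P where "P Y \<longleftrightarrow> Y \<subseteq> C \<and> Y \<noteq> {} \<and> overlap v Y \<le> card Y + 1" for Y
  have Cm: "C \<subseteq> meeting v" using C by (auto simp: meeting_closed_def)
  then have finC: "finite C" using finite_meeting finite_subset by blast
  obtain c where c: "c \<in> C" using C by auto
  have "P {c}" using overlap_singleton[OF v, of c] c Cm by (auto simp: P_def)
  moreover have "\<forall>Y. P Y \<longrightarrow> card Y \<le> card C" using finC by (auto simp: P_def intro: card_mono)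
  \<comment> \<open>A largest set obeying the bound is closed, since a further neighbour could be
    added at the price of one point; minimality of \<open>C\<close> makes it all of
    \<open>C\<close>.\<close>
  ultimately obtain Y where Y: "P Y" and max: "\<And>Z. P Z \<Longrightarrow> card Z \<le> card Y"
    using ex_has_greatest_nat[of P "{c}" card "Suc (card C)"] by (auto simp: less_Suc_eq_le)
  have "meeting_closed v Y"
    unfolding meeting_closed_def
  proof (intro conjI ballI subsetI)
    show "x \<in> meeting v" if "x \<in> Y" for x using that Y Cm by (auto simp: P_def)
    fix y z assume yz: "y \<in> Y" "z \<in> meeting y \<inter> meeting v"
    show "z \<in> Y"
    proof (rule ccontr)
      assume z: "z \<notin> Y"
      have "z \<in> C" using yz Y C(1) by (auto simp: P_def meeting_closed_def)
      have finY: "finite Y" using Y finC finite_subset by (auto simp: P_def)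
      have "overlap v (insert z Y) \<le> overlap v Y + 1"
        using yz Y Cm by (intro overlap_insert_adjacent[OF v]) (auto simp: P_def)
      then have "P (insert z Y)" using Y \<open>z \<in> C\<close> z finY by (auto simp: P_def)
      from max[OF this] show False using z finY by simp
    qed
  qed
  then have "Y = C" using minimal Y by (auto simp: P_def)
  then show ?thesis using Y by (simp add: P_def)
qed

text \<open>Components are peeled off one at a time: one of size k \<ge> s contributes at most k + 1
  points, and s(k + 1) \<le> (s + 1)k.\<close>

lemma overlap_closed:
  assumes v: "v \<in> A" and X: "meeting_closed v X"
    and s: "\<And>C. meeting_closed v C \<Longrightarrow> C \<noteq> {} \<Longrightarrow> s \<le> card C"
  shows "s * overlap v X \<le> (s + 1) * card X"
  using X
proof (induction "card X" arbitrary: X rule: less_induct)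
  case less
  have finX: "finite X" using less.prems finite_meeting finite_subset by (auto simp: meeting_closed_def)
  show ?case
  proof (cases "X = {}")
    case True then show ?thesis by (simp add: overlap_def)
  next
    case False
    define P where "P C \<longleftrightarrow> meeting_closed v C \<and> C \<noteq> {} \<and> C \<subseteq> X" for C
    have "P X" using False less.prems by (simp add: P_def)
    then obtain C where C: "P C" and min: "\<And>D. P D \<Longrightarrow> card C \<le> card D"
      using ex_has_least_nat[of P X card] by blast
    have finC: "finite C" using C finX finite_subset by (auto simp: P_def)
    have oC: "overlap v C \<le> card C + 1"
    proof (rule overlap_component[OF v])
      show "D = C" if "meeting_closed v D" "D \<noteq> {}" "D \<subseteq> C" for D
        using that min[of D] C finC by (intro card_seteq) (auto simp: P_def)
    qed (use C in \<open>auto simp: P_def\<close>)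
    have "meeting_closed v (X - C)"
      unfolding meeting_closed_def
    proof (intro conjI ballI subsetI)
      show "x \<in> meeting v" if "x \<in> X - C" for x using that less.prems by (auto simp: meeting_closed_def)
      fix x y assume x: "x \<in> X - C" and y: "y \<in> meeting x \<inter> meeting v"
      have "y \<in> X" using x y less.prems by (auto simp: meeting_closed_def)
      moreover have "y \<notin> C"
      proof
        assume "y \<in> C"
        have "x \<in> meeting v" using x less.prems by (auto simp: meeting_closed_def)
        then have "x \<in> meeting y \<inter> meeting v"
          using y meeting_sym[of y x] by (auto simp: meeting_def)
        then show False using \<open>y \<in> C\<close> C x by (auto simp: P_def meeting_closed_def)
      qed
      ultimately show "y \<in> X - C" by simp
    qed
    moreover have lt: "card (X - C) < card X"
      using C finX by (intro psubset_card_mono) (auto simp: P_def)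
    ultimately have IH: "s * overlap v (X - C) \<le> (s + 1) * card (X - C)"
      using less.hyps by blast
    have "overlap v X \<le> overlap v C + overlap v (X - C)"
      using overlap_Un[OF v, of C "X - C"] C by (simp add: P_def Un_absorb1)
    then have "s * overlap v X \<le> s * (card C + 1) + s * overlap v (X - C)"
      using oC by (metis add_le_mono1 add_mult_distrib2 mult_le_mono2 order_trans)
    also have "\<dots> \<le> (s + 1) * card C + (s + 1) * card (X - C)"
      using s[of C] C IH by (auto simp: P_def)
    also have "\<dots> = (s + 1) * card X"
      using C finC finX by (metis P_def add_mult_distrib2 card_Diff_subset card_mono le_add_diff_inverse)
    finally show ?thesis .
  qed
qed

text \<open>
  Otherwise every member meets more than half of the family. Count the points of the set of \<open>v\<close>
  through the components of the members meeting it: the members of a smallest component then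
  have too few other members to meet.
\<close>

lemma exists_small_overlap:
  assumes "A \<noteq> {}"
  shows "\<exists>v\<in>A. overlap v (A - {v}) \<le> card A"
proof (rule ccontr)
  assume "\<not> ?thesis"
  then have big: "overlap v (meeting v) \<ge> card A + 1" if "v \<in> A" for v
    using that by (auto simp: overlap_eq_meeting not_le Suc_le_eq)
  obtain v where v: "v \<in> A" using assms by auto
  define P where "P C \<longleftrightarrow> meeting_closed v C \<and> C \<noteq> {}" for C
  have "meeting v \<noteq> {}" using big[OF v] by (auto simp: overlap_def)
  then have "P (meeting v)" by (simp add: P_def meeting_closed_def)
  then obtain C where C: "P C" and min: "\<And>D. P D \<Longrightarrow> card C \<le> card D"
    using ex_has_least_nat[of P "meeting v" card] by blast
  define s where "s = card C"
  define t where "t = card (A - insert v (meeting v))"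
  have Cm: "C \<subseteq> meeting v" using C by (auto simp: P_def meeting_closed_def)
  have finC: "finite C" using Cm finite_meeting finite_subset by blast
  have s1: "s \<ge> 1" using C finC by (auto simp: s_def P_def Suc_le_eq card_gt_0_iff)
  have cA: "card A = 1 + card (meeting v) + t"
  proof -
    have "card A = card (insert v (meeting v)) + t"
      unfolding t_def using v finite_index
      by (metis (no_types, lifting) card_Diff_subset card_mono finite_subset insert_subset
          le_add_diff_inverse meeting_def mem_Collect_eq subsetI)
    then show ?thesis using finite_meeting[of v] by (simp add: meeting_def)
  qed
  have "s * overlap v (meeting v) \<le> (s + 1) * card (meeting v)"
    using min by (intro overlap_closed[OF v]) (auto simp: P_def s_def meeting_closed_def)
  then have 1: "s * (card A + 1) \<le> (s + 1) * card (meeting v)"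
    using big[OF v] by (meson mult_le_mono2 order_trans)
  obtain x where x: "x \<in> C" using C by (auto simp: P_def)
  have xA: "x \<in> A" using x Cm by (auto simp: meeting_def)
  \<comment> \<open>As \<open>C\<close> is closed, a member meeting \<open>x\<close> is
    \<open>v\<close>, another member of \<open>C\<close>, or one of the \<open>t\<close> further
    members that do not meet \<open>v\<close>.\<close>
  have "meeting x \<subseteq> insert v ((C - {x}) \<union> (A - insert v (meeting v)))"
    using x C by (auto simp: P_def meeting_closed_def meeting_def)
  then have "card (meeting x) \<le> card (insert v ((C - {x}) \<union> (A - insert v (meeting v))))"
    using finC finite_index by (intro card_mono) auto
  also have "\<dots> \<le> 1 + (card (C - {x}) + t)"
    using card_Un_le[of "C - {x}" "A - insert v (meeting v)"] finC finite_index
    by (simp add: t_def card_insert_if)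
  also have "\<dots> = s + t" using x finC s1 by (simp add: s_def)
  finally have "card A + 1 \<le> 2 * (s + t)"
    using big[OF xA] overlap_le_double[OF xA, of "meeting x"] by simp
  with cA have 2: "card (meeting v) + 2 \<le> 2 * s + t" by simp
  \<comment> \<open>With m the size of \<open>meeting v\<close>, this is s(t + 2) \<le> m, while
    fact \<open>2\<close> says m + 2 \<le> 2s + t. Together st + 2 \<le> t, impossible for s \<ge>
    1.\<close>
  have "s * (t + 2) \<le> card (meeting v)" using 1 unfolding cA by (simp add: algebra_simps)
  moreover have "t \<le> s * t" using s1 by simp
  ultimately show False using 2 by (simp add: algebra_simps)
qed

end

lemma helly_family_mono:
  assumes "helly_family A Nb" "B \<subseteq> A" shows "helly_family B Nb"
proof -
  interpret helly_family A Nb by fact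
  show ?thesis
    by unfold_locales
      (use assms(2) finite_index finite_Nb meet_le_2 helly in \<open>auto intro: finite_subset simp: subset_iff\<close>)
qed

text \<open>Induction by removing a member of small overlap: the a-th set added loses at most a
  points and the first loses none, so the losses total at most 2 + ... + a = a(a + 1)/2 - 1.
  Doubling and integers avoid halves and truncated subtraction.\<close>

lemma helly_family_card_Union:
  assumes "helly_family A Nb" "A \<noteq> {}" "\<And>v. v \<in> A \<Longrightarrow> card (Nb v) = d"
  shows "2 * int (card A) * int d - int (card A) * (int (card A) + 1) + 2
    \<le> 2 * int (card (\<Union> (Nb ` A)))"
  using assms
proof (induction "card A" arbitrary: A)
  case 0
  then show ?case by (auto simp: helly_family_def)
next
  case (Suc k)
  interpret helly_family A Nb by fact
  obtain v where v: "v \<in> A" and o: "overlap v (A - {v}) \<le> card A"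
    using exists_small_overlap Suc.prems by blast
  let ?U = "\<Union> (Nb ` (A - {v}))"
  have cA: "card (A - {v}) = k" using v finite_index Suc.hyps(2) by simp
  have finU: "finite ?U" using finite_index finite_Nb by auto
  have "\<Union> (Nb ` A) = ?U \<union> Nb v" using v by auto
  then have "int (card (\<Union> (Nb ` A))) + int (card (?U \<inter> Nb v)) = int (card ?U) + int d"
    using card_Un_Int[OF finU finite_Nb[OF v]] Suc.prems(3)[OF v] by simp
  moreover have "card (?U \<inter> Nb v) \<le> Suc k"
    using o Suc.hyps(2) by (simp add: overlap_def Int_commute)
  ultimately have step: "int (card (\<Union> (Nb ` A))) \<ge> int (card ?U) + int d - (int k + 1)" by linarith
  show ?case
  \<comment> \<open>A single set overlaps nothing, but \<open>step\<close> would still deduct one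
    point; treating it apart yields the summand 2.\<close>
  proof (cases "k = 0")
    case True
    then have "A - {v} = {}" using cA finite_index by simp
    then have "?U = {}" by auto
    then have "int (card (\<Union> (Nb ` A))) = int d" using v Suc.prems(3)[OF v] \<open>\<Union> (Nb ` A) = ?U \<union> Nb v\<close> by simp
    then show ?thesis using Suc.hyps(2)[symmetric] True by simp
  next
    case False
    then have "A - {v} \<noteq> {}" using cA by (metis card.empty)
    then have "2 * int k * int d - int k * (int k + 1) + 2 \<le> 2 * int (card ?U)"
      using Suc.hyps(1)[of "A - {v}"] cA helly_family_mono[OF Suc.prems(1), of "A - {v}"]
        Suc.prems(3) by auto
    then show ?thesis using step unfolding Suc.hyps(2)[symmetric] by (simp add: algebra_simps)
  qed
qed

section \<open>Separated sets in the hypercube\<close>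

definition differing :: "nat \<Rightarrow> bool list \<Rightarrow> bool list \<Rightarrow> nat set" where
  "differing N u v = {i. i < N \<and> u ! i \<noteq> v ! i}"

lemma differing_sym: "differing N u v = differing N v u"
  by (auto simp: differing_def)

text \<open>Hamming distance at least 2 expresses disjointness and the absence of cube edges in one
  condition.\<close>

definition separated :: "nat \<Rightarrow> bool list set \<Rightarrow> bool list set \<Rightarrow> bool" where
  "separated N A B \<longleftrightarrow> A \<subseteq> binary_strings N \<and> B \<subseteq> binary_strings N \<and>
     (\<forall>a\<in>A. \<forall>b\<in>B. 2 \<le> card (differing N a b))"

definition subcube :: "bool \<Rightarrow> bool list set \<Rightarrow> bool list set" where
  "subcube c A = {u. c # u \<in> A}"

lemma finite_binary_strings [simp]: "finite (binary_strings N)"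
  using finite_lists_length_eq[of "UNIV :: bool set" N] by (simp add: binary_strings_def)

lemma card_binary_strings: "card (binary_strings N) = 2 ^ N"
  using card_lists_length_eq[of "UNIV :: bool set" N] by (simp add: binary_strings_def)

lemma separated_sym: "separated N A B \<Longrightarrow> separated N B A"
  unfolding separated_def by (metis differing_sym)

lemma separated_disjoint: "separated N A B \<Longrightarrow> A \<inter> B = {}"
proof -
  have "card (differing N a a) = 0" for a by (simp add: differing_def)
  then show "separated N A B \<Longrightarrow> A \<inter> B = {}"
    unfolding separated_def by (metis disjoint_iff not_numeral_le_zero)
qed

lemma separated_card: 
  assumes "separated N A B" shows "card A + card B \<le> 2 ^ N"
proof -
  have fin: "finite A" "finite B"
    using assms by (auto simp: separated_def intro: finite_subset[OF _ finite_binary_strings])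
  have "card (A \<union> B) \<le> card (binary_strings N)"
    using assms by (intro card_mono) (auto simp: separated_def)
  then show ?thesis
    using card_Un_disjoint[OF fin separated_disjoint[OF assms]] by (simp add: card_binary_strings)
qed

lemma card_eq_card_subcubes:
  assumes "A \<subseteq> binary_strings (Suc N)"
  shows "card A = card (subcube False A) + card (subcube True A)"
proof -
  have fin: "finite (subcube c A)" for c
    by (rule finite_subset[OF _ finite_binary_strings[of N]])
      (use assms in \<open>auto simp: subcube_def binary_strings_def\<close>)
  have "A = (#) False ` subcube False A \<union> (#) True ` subcube True A" (is "_ = ?R")
  proof (rule set_eqI)
    fix u show "u \<in> A \<longleftrightarrow> u \<in> ?R"
      using assms by (cases u; cases "hd u") (auto simp: subcube_def binary_strings_def)
  qed
  also have "card ?R = card ((#) False ` subcube False A) + card ((#) True ` subcube True A)"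
    using fin by (intro card_Un_disjoint) auto
  also have "\<dots> = card (subcube False A) + card (subcube True A)"
    by (simp add: card_image)
  finally show ?thesis .
qed

lemma card_differing_Cons:
  "card (differing (Suc N) (x # u) (y # v)) = of_bool (x \<noteq> y) + card (differing N u v)"
proof -
  have "differing (Suc N) (x # u) (y # v) = (if x \<noteq> y then {0} else {}) \<union> Suc ` differing N u v"
  proof (rule set_eqI)
    fix i
    show "i \<in> differing (Suc N) (x # u) (y # v) \<longleftrightarrow>
      i \<in> (if x \<noteq> y then {0} else {}) \<union> Suc ` differing N u v"
      by (cases i) (auto simp: differing_def)
  qed
  moreover have "finite (differing N u v)" by (simp add: differing_def)
  ultimately show ?thesis by (simp add: card_image)
qed

lemma separated_subcube:
  assumes "separated (Suc N) A B"
  shows "separated N (subcube c A) (subcube c B)"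
  unfolding separated_def
proof (intro conjI ballI)
  show "subcube c A \<subseteq> binary_strings N" "subcube c B \<subseteq> binary_strings N"
    using assms by (auto simp: separated_def subcube_def binary_strings_def)
  fix a b assume "a \<in> subcube c A" "b \<in> subcube c B"
  then have "2 \<le> card (differing (Suc N) (c # a) (c # b))"
    using assms unfolding separated_def subcube_def by blast
  then show "2 \<le> card (differing N a b)"
    by (simp add: card_differing_Cons)
qed

text \<open>A vertex and its copy in the other half are at distance 1, so opposite halves of
  \<open>A\<close> and \<open>B\<close> become disjoint once the first bit is dropped.\<close>

lemma separated_subcubes_card:
  assumes "separated (Suc N) A B"
  shows "card (subcube c A) + card (subcube (\<not> c) B) \<le> 2 ^ N"
proof -
  have sub: "subcube c A \<subseteq> binary_strings N" "subcube (\<not> c) B \<subseteq> binary_strings N"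
    using assms by (auto simp: separated_def subcube_def binary_strings_def)
  have "a \<notin> subcube (\<not> c) B" if "a \<in> subcube c A" for a
  proof
    assume "a \<in> subcube (\<not> c) B"
    then have "2 \<le> card (differing (Suc N) (c # a) ((\<not> c) # a))"
      using assms that unfolding separated_def subcube_def by blast
    then show False by (simp add: card_differing_Cons) (simp add: differing_def)
  qed
  then have "subcube c A \<inter> subcube (\<not> c) B = {}" by blast
  then have "card (subcube c A \<union> subcube (\<not> c) B) = card (subcube c A) + card (subcube (\<not> c) B)"
    using sub by (intro card_Un_disjoint) (auto intro: finite_subset)
  moreover have "card (subcube c A \<union> subcube (\<not> c) B) \<le> card (binary_strings N)"
    using sub by (intro card_mono) auto
  ultimately show ?thesis by (simp add: card_binary_strings)
qed

text \<open>The complement of \<open>B\<close> contains the closed neighbourhood of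
  \<open>A\<close>. If both halves of \<open>A\<close> are nonempty, of sizes x and y, the inductive
  bounds add up to the required one plus 2(x - 1)(y - 1). If one half is empty, the copy in it of
  the other half supplies the missing vertices.\<close>

lemma separated_small_bound:
  assumes "separated N A B" "A \<noteq> {}"
  shows "2 * int (card A) * (int N + 1) - int (card A) * (int (card A) + 1) + 2
    \<le> 2 * (2 ^ N - int (card B))"
  using assms
proof (induction N arbitrary: A B)
  case 0
  then have A: "A = {[]}" by (auto simp: separated_def binary_strings_def)
  moreover have "card B = 0" using separated_card[OF 0(1)] A by simp
  ultimately show ?case by simp
next
  case (Suc N)
  define a b where "a c = int (card (subcube c A))" and "b c = int (card (subcube c B))" for c
  have ab: "int (card A) = a False + a True" "int (card B) = b False + b True"
    using Suc.prems card_eq_card_subcubes by (auto simp: a_def b_def separated_def)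
  have nn: "a c \<ge> 0" for c by (simp add: a_def)
  have pos: "a False + a True > 0"
  proof -
    have "finite A" using Suc.prems by (auto simp: separated_def intro: finite_subset)
    then show ?thesis using Suc.prems ab(1) by (metis card_gt_0_iff of_nat_0_less_iff)
  qed
  have IH: "a c = 0 \<or> 2 * a c * (int N + 1) - a c * (a c + 1) + 2 \<le> 2 * (2 ^ N - b c)" for c
    using Suc.IH[OF separated_subcube[OF Suc.prems(1)], of c] by (cases "subcube c A = {}") (auto simp: a_def b_def)
  have cross: "a c + b (\<not> c) \<le> 2 ^ N" for c
    using separated_subcubes_card[OF Suc.prems(1), of c] unfolding a_def b_def
    by (metis of_nat_add of_nat_le_iff of_nat_numeral of_nat_power)
  show ?case
  proof (cases "a False = 0 \<or> a True = 0")
    case True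
    then show ?thesis
      using IH[of False] IH[of True] cross[of False] cross[of True] pos
      unfolding ab by (elim disjE) (simp_all add: algebra_simps)
  next
    case False
    then have "(a False - 1) * (a True - 1) \<ge> 0" using nn by (smt (verit) mult_nonneg_nonneg)
    then show ?thesis
      using IH[of False] IH[of True] False unfolding ab by (simp add: algebra_simps)
  qed
qed

text \<open>
  Entry \<open>a\<close> bounds from below the size of the closed neighbourhood of an \<open>a\<close>-set of vertices of \<open>Q\<^sub>N\<close>.
  Split the set into halves of sizes \<open>x\<close> and \<open>a - x\<close>: the part of the closed neighbourhood in either
  subcube contains the closed neighbourhood of one half and a copy of the other.
\<close>

fun closure_bounds :: "nat \<Rightarrow> nat list" where
  "closure_bounds 0 = [0, 1]"
| "closure_bounds (Suc N) = (let L = closure_bounds N in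
     map (\<lambda>a. fold (\<lambda>x m. min m (max (L ! x) (a - x) + max (L ! (a - x)) x))
            [a - 2 ^ N..<Suc (min a (2 ^ N))] (2 * 2 ^ N))
       [0..<Suc (2 * 2 ^ N)])"

lemma fold_min_le:
  fixes f :: "nat \<Rightarrow> nat"
  shows "fold (\<lambda>x m. min m (f x)) xs k \<le> k \<and> (\<forall>x\<in>set xs. fold (\<lambda>x m. min m (f x)) xs k \<le> f x)"
proof (induction xs arbitrary: k)
  case (Cons y ys)
  show ?case using Cons.IH[of "min k (f y)"] by auto
qed simp

lemma separated_closure_bounds:
  assumes "separated N A B"
  shows "closure_bounds N ! card A + card B \<le> 2 ^ N"
  using assms
proof (induction N arbitrary: A B)
  case 0
  then have "A \<subseteq> {[]}" by (auto simp: separated_def binary_strings_def)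
  then consider "A = {}" | "A = {[]}" by auto
  then show ?case
    using separated_card[OF 0] by cases auto
next
  case (Suc N)
  define a b where "a c = card (subcube c A)" and "b c = card (subcube c B)" for c
  let ?L = "closure_bounds N"
  have ab: "card A = a False + a True" "card B = b False + b True"
    using Suc.prems card_eq_card_subcubes by (auto simp: a_def b_def separated_def)
  have IH: "?L ! a c + b c \<le> 2 ^ N" for c
    unfolding a_def b_def using Suc.IH[OF separated_subcube[OF Suc.prems]] .
  have cross: "a c + b (\<not> c) \<le> 2 ^ N" for c
    using separated_subcubes_card[OF Suc.prems, of c] unfolding a_def b_def .
  have le: "a c \<le> 2 ^ N" for c using cross[of c] by simp
  define f where "f x = max (?L ! x) (card A - x) + max (?L ! (card A - x)) x" for x
  have "closure_bounds (Suc N) ! card A =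
     fold (\<lambda>x m. min m (f x)) [card A - 2 ^ N..<Suc (min (card A) (2 ^ N))] (2 * 2 ^ N)"
  proof -
    have "card A < Suc (2 * 2 ^ N)"
      using le[of False] le[of True] ab(1) by simp
    then show ?thesis by (simp add: Let_def f_def del: upt_Suc)
  qed
  also have "\<dots> \<le> f (a False)"
    using le[of False] le[of True] ab(1)
    by (intro fold_min_le[THEN conjunct2, rule_format]) auto
  also have "\<dots> = max (?L ! a False) (a True) + max (?L ! a True) (a False)"
    by (simp add: f_def ab(1))
  finally show ?case
    using IH[of False] IH[of True] cross[of False] cross[of True] ab(2) by auto
qed

text \<open>The arithmetic of the step from dimension M to M + 1. Here \<open>a0\<close>,
  \<open>a1\<close> are the sizes of the halves of one side and \<open>s0\<close>, \<open>s1\<close>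
  the numbers of cut vertices in the halves; \<open>F0\<close>, \<open>F1\<close> come from the
  bound for small sets, \<open>Y0\<close> from comparing opposite halves, and \<open>U1\<close>,
  \<open>V0\<close>, \<open>V1\<close> from the induction hypothesis.\<close>

lemma halves_bound_ordered:
  fixes M a0 a1 s0 s1 :: int
  assumes M: "M \<ge> 6" and nn: "a0 \<ge> 0" and le: "a0 \<le> a1"
    and F0: "a0 \<ge> 1 \<Longrightarrow> 2 * s0 \<ge> 2 * a0 * M - a0 * (a0 + 1) + 2"
    and F1: "a1 \<ge> 1 \<Longrightarrow> 2 * s1 \<ge> 2 * a1 * M - a1 * (a1 + 1) + 2"
    and Y0: "s0 \<ge> a1 - a0"
    and V0: "a0 \<ge> M + 3 \<Longrightarrow> 2 * s0 \<ge> M * (M - 1) + 2 * M - 2"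
    and U1: "a1 \<ge> M + 2 \<Longrightarrow> 2 * s1 \<ge> M * (M - 1) + 2 * M - 6"
    and V1: "a1 \<ge> M + 3 \<Longrightarrow> 2 * s1 \<ge> M * (M - 1) + 2 * M - 2"
  shows "(a0 + a1 \<ge> M + 4 \<longrightarrow> 2 * (s0 + s1) \<ge> M * (M - 1) + 4 * M + 2) \<and>
         (a0 + a1 \<ge> M + 3 \<longrightarrow> 2 * (s0 + s1) \<ge> M * (M - 1) + 4 * M - 4)"
proof -
  have MM: "M * (M - 1) \<ge> 6 * (6 - 1)" using M by (intro mult_mono) auto
  \<comment> \<open>The bound in \<open>F0\<close> is concave in \<open>a0\<close>, so between 2 and
    M + 2 it is smallest at an endpoint; for M \<ge> 5 this is 2, with value 4M - 4.\<close>
  have chord2: "2 * s0 \<ge> 4 * M - 4" if "2 \<le> a0" "a0 \<le> M + 2"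
  proof -
    have "(a0 - 2) * (M + 2 - a0) \<ge> 0" "(a0 - 2) * (M - 5) \<ge> 0" using that M by auto
    then show ?thesis using F0 that by (simp add: algebra_simps)
  qed
  consider "a0 \<ge> M + 3" | "a1 \<ge> M + 3" "a0 \<le> M + 2" | "a1 = M + 2" "a0 \<le> M + 2"
    | "a1 = M + 1" | "a1 \<le> M"
    using le by linarith
  then show ?thesis
  proof cases
    case 1
    then show ?thesis using V0 V1 le MM M by (smt (verit))
  next
    case 2
    consider "a0 = 0" | "a0 = 1" | "2 \<le> a0" using nn by linarith
    then show ?thesis using V1 2 M Y0 chord2 by cases (auto simp: algebra_simps)
  next
    case 3
    consider "a0 = 0" | "a0 = 1" | "2 \<le> a0" using nn by linarith
    then show ?thesis using U1 3 M Y0 chord2 by cases (auto simp: algebra_simps)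
  next
    case 4
    have s1: "2 * s1 \<ge> M * (M - 1)" using F1 4 M by (simp add: algebra_simps)
    \<comment> \<open>Concavity again, now between 3 and M + 1. Here M \<ge> 6 is tight: 6M - 10
      \<ge> 4M + 2.\<close>
    have "2 * s0 \<ge> 6 * M - 10" if "3 \<le> a0"
    proof -
      have "(a0 - 3) * (M + 1 - a0) \<ge> 0" "(a0 - 3) * (M - 5) \<ge> 0" using that M le 4 by auto
      then show ?thesis using F0 that by (simp add: algebra_simps)
    qed
    then show ?thesis using s1 4 chord2 M le by (smt (verit))
  next
    case 5
    have "2 * (s0 + s1) \<ge> M * (M - 1) + 4 * M + 2" if "a0 + a1 \<ge> M + 3"
    proof -
      \<comment> \<open>Both sizes lie between 3 and M, where the quadratic is at least its chord of
        slope M - 4; the third product bounds the total along the chord.\<close>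
      have "(a0 - 3) * (M - a0) \<ge> 0" "(a1 - 3) * (M - a1) \<ge> 0" "(a0 + a1 - (M + 3)) * (M - 4) \<ge> 0"
        using that M le 5 by auto
      then show ?thesis using F0 F1 that M le 5 by (simp add: algebra_simps)
    qed
    then show ?thesis by auto
  qed
qed

lemma halves_bound:
  fixes M a0 a1 s0 s1 :: int
  assumes "M \<ge> 6" "a0 \<ge> 0" "a1 \<ge> 0"
    and "a0 \<ge> 1 \<Longrightarrow> 2 * s0 \<ge> 2 * a0 * M - a0 * (a0 + 1) + 2"
    and "a1 \<ge> 1 \<Longrightarrow> 2 * s1 \<ge> 2 * a1 * M - a1 * (a1 + 1) + 2"
    and "s0 \<ge> a1 - a0" "s1 \<ge> a0 - a1"
    and "a0 \<ge> M + 2 \<Longrightarrow> 2 * s0 \<ge> M * (M - 1) + 2 * M - 6"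
    and "a0 \<ge> M + 3 \<Longrightarrow> 2 * s0 \<ge> M * (M - 1) + 2 * M - 2"
    and "a1 \<ge> M + 2 \<Longrightarrow> 2 * s1 \<ge> M * (M - 1) + 2 * M - 6"
    and "a1 \<ge> M + 3 \<Longrightarrow> 2 * s1 \<ge> M * (M - 1) + 2 * M - 2"
  shows "(a0 + a1 \<ge> M + 4 \<longrightarrow> 2 * (s0 + s1) \<ge> M * (M - 1) + 4 * M + 2) \<and>
         (a0 + a1 \<ge> M + 3 \<longrightarrow> 2 * (s0 + s1) \<ge> M * (M - 1) + 4 * M - 4)"
proof (cases "a0 \<le> a1")
  case True
  then show ?thesis using halves_bound_ordered[of M a0 a1 s0 s1] assms by auto
next
  case False
  then show ?thesis using halves_bound_ordered[of M a1 a0 s1 s0] assms by (auto simp: add.commute)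
qed

text \<open>Lets exponentially large cuts beat the quadratic bounds. The linear terms make the
  doubled value 2 * 2 ^ M - 4(M + 2) at least M(M - 1) + 4M + 2, as the last case of
  \<open>separated_step\<close> requires.\<close>

lemma power2_ge:
  assumes "M \<ge> 6" shows "2 * 2 ^ M \<ge> int M * (int M - 1) + 8 * int M + 10"
  using assms
proof (induction M rule: dec_induct)
  case (step k)
  have "int (Suc k) * (int (Suc k) - 1) + 8 * int (Suc k) + 10 =
      int k * (int k - 1) + 10 * int k + 18"
    by (simp add: algebra_simps)
  also have "\<dots> \<le> 2 * (int k * (int k - 1) + 8 * int k + 10)"
    using step by simp
  also have "\<dots> \<le> 2 * 2 ^ Suc k" using step.IH by simp
  finally show ?case .
qed simp

section \<open>The vertex isoperimetric inequality in the hypercube\<close>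

definition cut_size :: "nat \<Rightarrow> bool list set \<Rightarrow> bool list set \<Rightarrow> int" where
  "cut_size N A B = 2 ^ N - int (card A) - int (card B)"

lemma cut_size_commute: "cut_size N A B = cut_size N B A"
  by (simp add: cut_size_def)

text \<open>With both halves of \<open>B\<close> large, whether \<open>U\<close> and
  \<open>V\<close> apply in a half depends only on how many vertices of \<open>A\<close> lie there;
  this reduces the claim to \<open>halves_bound\<close>.\<close>

lemma separated_step_one_side:
  assumes M: "M \<ge> 6"
    and U: "\<And>A B. separated M A B \<Longrightarrow> card A \<ge> M + 2 \<Longrightarrow> card B \<ge> M + 2 \<Longrightarrow>
       2 * cut_size M A B \<ge> int M * (int M - 1) + 2 * int M - 6"
    and V: "\<And>A B. separated M A B \<Longrightarrow> card A \<ge> M + 3 \<Longrightarrow> card B \<ge> M + 3 \<Longrightarrow>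
       2 * cut_size M A B \<ge> int M * (int M - 1) + 2 * int M - 2"
    and sep: "separated (Suc M) A B"
    and B: "\<And>c. card (subcube c B) \<ge> M + 3"
  shows "(card A \<ge> M + 4 \<longrightarrow>
           2 * cut_size (Suc M) A B \<ge> int M * (int M - 1) + 4 * int M + 2) \<and>
         (card A \<ge> M + 3 \<longrightarrow>
           2 * cut_size (Suc M) A B \<ge> int M * (int M - 1) + 4 * int M - 4)"
proof -
  define a where "a c = int (card (subcube c A))" for c
  define s where "s c = cut_size M (subcube c A) (subcube c B)" for c
  note sub = separated_subcube[OF sep]
  have cA: "int (card A) = a False + a True"
    using sep card_eq_card_subcubes by (auto simp: a_def separated_def)
  have cut: "cut_size (Suc M) A B = s False + s True"
    using sep card_eq_card_subcubes[of A M] card_eq_card_subcubes[of B M]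
    by (simp add: s_def cut_size_def separated_def)
  have F: "2 * a c * int M - a c * (a c + 1) + 2 \<le> 2 * s c" if "1 \<le> a c" for c
  proof -
    have "subcube c A \<noteq> {}" using that by (auto simp: a_def)
    from separated_small_bound[OF sub this] show ?thesis
      by (simp add: a_def s_def cut_size_def algebra_simps)
  qed
  have Y: "a (\<not> c) - a c \<le> s c" for c
  proof -
    have "int (card (subcube (\<not> c) A)) + int (card (subcube c B)) \<le> 2 ^ M"
      using separated_subcubes_card[OF sep, of "\<not> c"]
      by (metis (full_types) of_nat_add of_nat_le_iff of_nat_numeral of_nat_power)
    then show ?thesis by (simp add: a_def s_def cut_size_def)
  qed
  have U': "int M * (int M - 1) + 2 * int M - 6 \<le> 2 * s c" if "int M + 2 \<le> a c" for c
    unfolding s_def using that B[of c] by (intro U sub) (auto simp: a_def)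
  have V': "int M * (int M - 1) + 2 * int M - 2 \<le> 2 * s c" if "int M + 3 \<le> a c" for c
    unfolding s_def using that B[of c] by (intro V sub) (auto simp: a_def)
  have "(a False + a True \<ge> int M + 4 \<longrightarrow> 2 * (s False + s True) \<ge> int M * (int M - 1) + 4 * int M + 2) \<and>
        (a False + a True \<ge> int M + 3 \<longrightarrow> 2 * (s False + s True) \<ge> int M * (int M - 1) + 4 * int M - 4)"
    using M F U' V' Y[of False] Y[of True] by (intro halves_bound) (auto simp: a_def)
  then show ?thesis unfolding cut using cA by auto
qed

text \<open>Either one side is large in both halves, or each side has a half with at most M + 2
  vertices and the cut has at least 2 ^ M - 2(M + 2) vertices.\<close>

lemma separated_step:
  assumes M: "M \<ge> 6"
    and U: "\<And>A B. separated M A B \<Longrightarrow> card A \<ge> M + 2 \<Longrightarrow> card B \<ge> M + 2 \<Longrightarrow>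
       2 * cut_size M A B \<ge> int M * (int M - 1) + 2 * int M - 6"
    and V: "\<And>A B. separated M A B \<Longrightarrow> card A \<ge> M + 3 \<Longrightarrow> card B \<ge> M + 3 \<Longrightarrow>
       2 * cut_size M A B \<ge> int M * (int M - 1) + 2 * int M - 2"
    and sep: "separated (Suc M) A B"
  shows "(card A \<ge> M + 4 \<and> card B \<ge> M + 4 \<longrightarrow>
           2 * cut_size (Suc M) A B \<ge> int M * (int M - 1) + 4 * int M + 2) \<and>
         (card A \<ge> M + 3 \<and> card B \<ge> M + 3 \<longrightarrow>
           2 * cut_size (Suc M) A B \<ge> int M * (int M - 1) + 4 * int M - 4)"
proof -
  consider "\<And>c. card (subcube c B) \<ge> M + 3" | "\<And>c. card (subcube c A) \<ge> M + 3"
    | c d where "card (subcube c A) \<le> M + 2" "card (subcube d B) \<le> M + 2"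
    by (metis Suc_leI add_Suc_right leI not_less_eq_eq numeral_2_eq_2 numeral_3_eq_3)
  then show ?thesis
  proof cases
    case 1
    then show ?thesis using separated_step_one_side[OF M U V sep] by blast
  next
    case 2
    then show ?thesis using separated_step_one_side[OF M U V separated_sym[OF sep]]
      by (auto simp: cut_size_commute)
  next
    case (3 c d)
    have cA: "int (card A) = int (card (subcube c A)) + int (card (subcube (\<not> c) A))"
     and cB: "int (card B) = int (card (subcube c B)) + int (card (subcube (\<not> c) B))"
      using sep card_eq_card_subcubes[of A M] card_eq_card_subcubes[of B M]
      by (cases c; simp add: separated_def)+
    \<comment> \<open>Any half of \<open>A\<close> and any half of \<open>B\<close> have at most
      \<open>2 ^ M\<close> vertices together. Applied to the two halves not known to be small, this
      bounds both sides together by 2 ^ M + 2(M + 2).\<close>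
    have "int (card (subcube e A)) + int (card (subcube f B)) \<le> 2 ^ M" for e f
    proof -
      have "card (subcube e A) + card (subcube f B) \<le> 2 ^ M"
        using separated_card[OF separated_subcube[OF sep, of e]] separated_subcubes_card[OF sep, of e]
        by (cases "f = e") auto
      then show ?thesis by (metis of_nat_add of_nat_le_iff of_nat_numeral of_nat_power)
    qed
    note le = this[of c c] this[of "\<not> c" "\<not> c"] this[of "\<not> c" c] this[of c "\<not> c"]
    have "d = c \<or> d = (\<not> c)" by auto
    then have "2 * cut_size (Suc M) A B \<ge> 2 * 2 ^ M - 4 * (int M + 2)"
      using 3 le cA cB unfolding cut_size_def by (elim disjE) auto
    then show ?thesis using power2_ge[OF M] by (smt (verit))
  qed
qed

text \<open>The base case, by evaluating the table: 18 and 20 are N(N + 1)/2 - 3 and N(N + 1)/2 - 1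
  at N = 6.\<close>

lemma separated_bound_6:
  assumes "separated 6 A B"
  shows "card A \<ge> 8 \<Longrightarrow> card B \<ge> 8 \<Longrightarrow> cut_size 6 A B \<ge> 18"
    and "card A \<ge> 9 \<Longrightarrow> card B \<ge> 9 \<Longrightarrow> cut_size 6 A B \<ge> 20"
proof -
  \<comment> \<open>An entry of at least 57 leaves fewer than 8 of the 64 vertices for
    \<open>B\<close>, and one of at least 56 fewer than 9; hence the caps.\<close>
  have check: "list_all (\<lambda>(a, l). (a \<ge> 8 \<longrightarrow> min (a + 18) 57 \<le> l) \<and> (a \<ge> 9 \<longrightarrow> min (a + 20) 56 \<le> l))
     (zip [0..<65] (closure_bounds 6))"
    by code_simp
  have len: "length (closure_bounds N) = Suc (2 ^ N)" for N
    by (cases N) (simp_all add: Let_def del: upt_Suc)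
  have lt: "card A < 65" using separated_card[OF assms] by simp
  have "zip [0..<65] (closure_bounds 6) ! card A = ([0..<65] ! card A, closure_bounds 6 ! card A)"
    using lt by (intro nth_zip) (simp_all add: len del: upt_Suc)
  moreover have "[0..<65] ! card A = card A" using lt by (subst nth_upt) auto
  moreover have "card A < length (zip [0..<65] (closure_bounds 6))"
    using lt by (simp add: len del: upt_Suc)
  ultimately have *: "(card A \<ge> 8 \<longrightarrow> min (card A + 18) 57 \<le> closure_bounds 6 ! card A) \<and>
     (card A \<ge> 9 \<longrightarrow> min (card A + 20) 56 \<le> closure_bounds 6 ! card A)"
    using check unfolding list_all_length by (metis (no_types, lifting) case_prod_conv)
  have "closure_bounds 6 ! card A + card B \<le> 64"
    using separated_closure_bounds[OF assms] by simp
  with * show "card A \<ge> 8 \<Longrightarrow> card B \<ge> 8 \<Longrightarrow> cut_size 6 A B \<ge> 18"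
    and "card A \<ge> 9 \<Longrightarrow> card B \<ge> 9 \<Longrightarrow> cut_size 6 A B \<ge> 20"
    by (auto simp: cut_size_def)
qed

text \<open>Halved, the bounds are N(N + 1)/2 - 3 and N(N + 1)/2 - 1. The lower threshold is carried
  along because the step meets halves of exactly M + 2 vertices. The step yields one vertex more
  than the second bound asks for, so the value 20 at N = 6 suffices to start.\<close>

lemma separated_bounds:
  assumes "N \<ge> 6"
  shows "(\<forall>A B. separated N A B \<longrightarrow> card A \<ge> N + 2 \<longrightarrow> card B \<ge> N + 2 \<longrightarrow>
       2 * cut_size N A B \<ge> int N * (int N - 1) + 2 * int N - 6) \<and>
    (\<forall>A B. separated N A B \<longrightarrow> card A \<ge> N + 3 \<longrightarrow> card B \<ge> N + 3 \<longrightarrow>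
       2 * cut_size N A B \<ge> int N * (int N - 1) + 2 * int N - 2)"
  using assms
proof (induction N rule: dec_induct)
  case base
  show ?case using separated_bound_6 by fastforce
next
  case (step M)
  have eq: "int (Suc M) * (int (Suc M) - 1) + 2 * int (Suc M) - 6 = int M * (int M - 1) + 4 * int M - 4"
     "int (Suc M) * (int (Suc M) - 1) + 2 * int (Suc M) - 2 = int M * (int M - 1) + 4 * int M"
    by (simp_all add: algebra_simps)
  have *: "(card A \<ge> M + 4 \<and> card B \<ge> M + 4 \<longrightarrow>
           2 * cut_size (Suc M) A B \<ge> int M * (int M - 1) + 4 * int M + 2) \<and>
         (card A \<ge> M + 3 \<and> card B \<ge> M + 3 \<longrightarrow>
           2 * cut_size (Suc M) A B \<ge> int M * (int M - 1) + 4 * int M - 4)"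
    if "separated (Suc M) A B" for A B
    using step.IH step.hyps that by (intro separated_step) auto
  show ?case unfolding eq
  proof (intro conjI allI impI)
    fix A B assume "separated (Suc M) A B" "Suc M + 2 \<le> card A" "Suc M + 2 \<le> card B"
    then show "int M * (int M - 1) + 4 * int M - 4 \<le> 2 * cut_size (Suc M) A B"
      using *[of A B] by simp
  next
    fix A B assume "separated (Suc M) A B" "Suc M + 3 \<le> card A" "Suc M + 3 \<le> card B"
    then show "int M * (int M - 1) + 4 * int M \<le> 2 * cut_size (Suc M) A B"
      using *[of A B] by simp
  qed
qed

text \<open>One more application of \<open>separated_step\<close>, from dimension n - 1 \<ge> 6,
  gains the vertex missing in \<open>separated_bounds\<close>.\<close>

lemma separated_large_bound:
  assumes "n \<ge> 7" "separated n A B" "card A \<ge> n + 3" "card B \<ge> n + 3"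
  shows "2 * cut_size n A B \<ge> int n * (int n + 1)"
proof -
  obtain M where n: "n = Suc M" using assms(1) by (cases n) auto
  have "M \<ge> 6" using assms n by simp
  have "int n * (int n + 1) = int M * (int M - 1) + 4 * int M + 2" by (simp add: n algebra_simps)
  moreover have "2 * cut_size (Suc M) A B \<ge> int M * (int M - 1) + 4 * int M + 2"
    using separated_step[OF \<open>M \<ge> 6\<close>, of A B] separated_bounds[OF \<open>M \<ge> 6\<close>] assms n by auto
  ultimately show ?thesis by (simp add: n)
qed

section \<open>Closed neighbourhoods in the folded hypercube\<close>

text \<open>
  The sets in which a vertex can differ from a member of its closed neighbourhood in \<open>FQ\<^sub>n\<close>.
\<close>

definition gens :: "nat \<Rightarrow> nat set set" where
  "gens n = {X. X \<subseteq> {..<n} \<and> (card X \<le> 1 \<or> X = {..<n})}"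

definition subsingleton :: "nat set \<Rightarrow> bool" where
  "subsingleton X \<longleftrightarrow> X = {} \<or> (\<exists>i. X = {i})"

lemma card_sym_diff_subsingleton2: "subsingleton a \<Longrightarrow> subsingleton b \<Longrightarrow> card (sym_diff a b) \<le> 2"
  unfolding subsingleton_def by (elim disjE exE) (auto simp: card_insert_if insert_Diff_if)

text \<open>Distinct sets of this kind are disjoint and at most one is empty, so every set except
  possibly one contributes an element.\<close>

lemma card_sym_diff_subsingleton3:
  "subsingleton a \<Longrightarrow> subsingleton b \<Longrightarrow> subsingleton c \<Longrightarrow> a \<noteq> b \<Longrightarrow> a \<noteq> c \<Longrightarrow> b \<noteq> c \<Longrightarrow>
    card (sym_diff a (sym_diff b c)) \<in> {2..3}"
  unfolding subsingleton_def by (elim disjE exE) (auto simp: card_insert_if insert_Diff_if Un_commute)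

lemma card_sym_diff_subsingleton4:
  "subsingleton a \<Longrightarrow> subsingleton b \<Longrightarrow> subsingleton c \<Longrightarrow> subsingleton d \<Longrightarrow> distinct [a, b, c, d] \<Longrightarrow>
    card (sym_diff (sym_diff a b) (sym_diff c d)) \<in> {3..4}"
  unfolding subsingleton_def by (elim disjE exE) (auto simp: card_insert_if insert_Diff_if)

lemma gens_cases: "n \<ge> 2 \<Longrightarrow> X \<in> gens n \<Longrightarrow> subsingleton X \<and> X \<subseteq> {..<n} \<or> X = {..<n}"
  by (auto simp: gens_def subsingleton_def le_Suc_eq card_1_singleton_iff card_eq_0_iff finite_subset[OF _ finite_lessThan])

lemma subsingleton_sidon:
  "subsingleton a \<Longrightarrow> subsingleton b \<Longrightarrow> subsingleton c \<Longrightarrow> subsingleton d \<Longrightarrow> a \<noteq> b \<Longrightarrow> sym_diff a b = sym_diff c d \<Longrightarrow> c = a \<or> c = b"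
  unfolding subsingleton_def by (elim disjE exE) (auto simp: insert_Diff_if doubleton_eq_iff split: if_splits)

lemma card_full_sym_diff:
  fixes X :: "nat set"
  assumes "X \<subseteq> {..<n}" shows "card (sym_diff {..<n} X) = n - card X"
proof -
  have "sym_diff {..<n} X = {..<n} - X" using assms by auto
  then show ?thesis using assms by (simp add: card_Diff_subset finite_subset)
qed

lemma card_subsingleton: "subsingleton X \<Longrightarrow> card X \<le> 1"
  by (auto simp: subsingleton_def)

text \<open>A sum of two generators is small unless exactly one of them is the whole set, which
  makes it the complement of a set with at most one element.\<close>

lemma card_gens_sym_diff:
  assumes "n \<ge> 2" "s \<in> gens n" "t \<in> gens n"
  shows "card (sym_diff s t) \<le> 2 \<or> n - 1 \<le> card (sym_diff s t)"
proof -
  consider "subsingleton s" "subsingleton t" | "s = {..<n}" "t = {..<n}"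
    | "s = {..<n}" "subsingleton t" "t \<subseteq> {..<n}" | "t = {..<n}" "subsingleton s" "s \<subseteq> {..<n}"
    using gens_cases assms by blast
  then show ?thesis
  proof cases
    case 1 then show ?thesis using card_sym_diff_subsingleton2 by blast
  next
    case 3 then show ?thesis using card_full_sym_diff[of t n] card_subsingleton[of t] by auto
  next
    case 4 then show ?thesis using card_full_sym_diff[of s n] card_subsingleton[of s] by (auto simp: Un_commute)
  qed simp
qed

text \<open>The left side has at least n - 1 \<ge> 3 elements, too many for two subsingletons, so
  the whole set also occurs on the right and cancels.\<close>

lemma sym_diff_full_eqD:
  assumes "n \<ge> 4" "t \<in> gens n" "s' \<in> gens n" "t' \<in> gens n" "t \<noteq> {..<n}"
    and eq: "sym_diff {..<n} t = sym_diff s' t'"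
  shows "s' = {..<n} \<or> s' = t"
proof -
  have n2: "n \<ge> 2" using assms(1) by simp
  have t: "subsingleton t" "t \<subseteq> {..<n}" using gens_cases[OF n2 assms(2)] assms(5) by blast+
  then have card: "card (sym_diff s' t') \<ge> 3"
    using card_full_sym_diff[of t n] card_subsingleton[of t] assms(1) unfolding eq by simp
  have sub: "s' \<subseteq> {..<n}" using assms(3) by (simp add: gens_def)
  consider "s' = {..<n}" | "subsingleton s'" "subsingleton t'" | "t' = {..<n}"
    using gens_cases[OF n2 assms(3)] gens_cases[OF n2 assms(4)] by blast
  then show ?thesis
  proof cases
    case 2 then show ?thesis using card_sym_diff_subsingleton2[of s' t'] card by simp
  next
    case 3
    then have "s' = t" using eq t(2) sub by blast
    then show ?thesis by simp
  qed simp
qed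

text \<open>The generators form a Sidon set in the group of subsets under symmetric difference; the
  size of a sum reveals whether the whole set takes part.\<close>

lemma gens_sidon:
  assumes "n \<ge> 4" "s \<in> gens n" "t \<in> gens n" "s' \<in> gens n" "t' \<in> gens n" "s \<noteq> t"
    and eq: "sym_diff s t = sym_diff s' t'"
  shows "s' = s \<or> s' = t"
proof -
  have n2: "n \<ge> 2" using assms(1) by simp
  note full = sym_diff_full_eqD[OF assms(1)]
  have eq': "sym_diff t s = sym_diff s' t'" using eq by (simp only: Un_commute)
  consider "s = {..<n}" | "t = {..<n}" | "s' = {..<n}" "s \<noteq> {..<n}" "t \<noteq> {..<n}"
    | "t' = {..<n}" "s \<noteq> {..<n}" "t \<noteq> {..<n}" | "subsingleton s" "subsingleton t" "subsingleton s'" "subsingleton t'"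
    using gens_cases[OF n2 assms(2)] gens_cases[OF n2 assms(3)] gens_cases[OF n2 assms(4)]
      gens_cases[OF n2 assms(5)] by blast
  then show ?thesis
  proof cases
    case 1 then show ?thesis using full[OF assms(3,4,5)] eq \<open>s \<noteq> t\<close> by blast
  next
    case 2 then show ?thesis using full[OF assms(2,4,5)] eq' \<open>s \<noteq> t\<close> by blast
  next
    case 3
    have "t' \<noteq> {..<n}" using 3 eq assms(6) by blast
    then show ?thesis
      using full[OF assms(5) assms(2,3)] full[OF assms(5) assms(3,2)] 3 eq eq' \<open>s \<noteq> t\<close> by metis
  next
    case 4
    have "s' \<noteq> {..<n}" using 4 eq assms(6) by blast
    moreover have "sym_diff {..<n} s' = sym_diff s t" "sym_diff {..<n} s' = sym_diff t s"
      using 4 eq by blast+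
    ultimately show ?thesis
      using full[OF assms(4) assms(2,3)] full[OF assms(4) assms(3,2)] 4 \<open>s \<noteq> t\<close> by metis
  next
    case 5 then show ?thesis using subsingleton_sidon eq \<open>s \<noteq> t\<close> by metis
  qed
qed

lemma card_sym_diff_full4:
  assumes "n \<ge> 6" "b \<in> gens n" "c \<in> gens n" "d \<in> gens n" "distinct [{..<n}, b, c, d]"
  shows "card (sym_diff (sym_diff {..<n} b) (sym_diff c d)) \<in> {3..n - 2}"
proof -
  have sm: "subsingleton b" "subsingleton c" "subsingleton d" and sub: "b \<subseteq> {..<n}" "c \<subseteq> {..<n}" "d \<subseteq> {..<n}"
    using gens_cases[of n b] gens_cases[of n c] gens_cases[of n d] assms by (auto simp del: lessThan_eq_iff)
  define Y where "Y = sym_diff b (sym_diff c d)"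
  have "card (sym_diff {..<n} Y) = n - card Y"
    using sub unfolding Y_def by (intro card_full_sym_diff) blast
  moreover have "card Y \<in> {2..3}"
    unfolding Y_def using assms(5) by (intro card_sym_diff_subsingleton3[OF sm]) auto
  ultimately have "card (sym_diff {..<n} Y) \<in> {3..n - 2}"
    using assms(1) unfolding atLeastAtMost_iff by linarith
  moreover have "sym_diff (sym_diff {..<n} b) (sym_diff c d) = sym_diff {..<n} Y"
    unfolding Y_def by blast
  ultimately show ?thesis by (simp only:)
qed

text \<open>Four distinct generators have a sum with between 3 and n - 2 elements, whereas a sum of
  two has at most 2 or at least n - 1.\<close>

lemma gens_helly:
  assumes n: "n \<ge> 6" and g: "s \<in> gens n" "t \<in> gens n" "s' \<in> gens n" "t' \<in> gens n"
    and u: "u \<in> gens n" "u' \<in> gens n"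
    and ne: "s \<noteq> t" "s' \<noteq> t'" and eq: "sym_diff (sym_diff s t) (sym_diff s' t') = sym_diff u u'"
  shows "{s, t} \<inter> {s', t'} \<noteq> {}"
proof
  assume "{s, t} \<inter> {s', t'} = {}"
  then have d: "distinct [s, t, s', t']" using ne by auto
  let ?R = "sym_diff (sym_diff s t) (sym_diff s' t')"
  have n2: "n \<ge> 2" using n by simp
  have R: "?R = sym_diff (sym_diff t s) (sym_diff s' t')" "?R = sym_diff (sym_diff s' t') (sym_diff s t)"
    "?R = sym_diff (sym_diff t' s') (sym_diff s t)"
    by (simp_all only: Un_commute)
  have "card ?R \<in> {3..n - 2}"
  proof -
    consider "s = {..<n}" | "t = {..<n}" | "s' = {..<n}" | "t' = {..<n}"
      | "subsingleton s" "subsingleton t" "subsingleton s'" "subsingleton t'"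
      using gens_cases[OF n2 g(1)] gens_cases[OF n2 g(2)] gens_cases[OF n2 g(3)] gens_cases[OF n2 g(4)] by blast
    then show ?thesis
    proof cases
      case 1 then show ?thesis using card_sym_diff_full4[OF n g(2,3,4)] d by blast
    next
      case 2
      then have "distinct [{..<n}, s, s', t']" using d by force
      then show ?thesis unfolding R(1) using card_sym_diff_full4[OF n g(1,3,4)] 2 by blast
    next
      case 3
      then have "distinct [{..<n}, t', s, t]" using d by force
      then show ?thesis unfolding R(2) using card_sym_diff_full4[OF n g(4,1,2)] 3 by blast
    next
      case 4
      then have "distinct [{..<n}, s', s, t]" using d by force
      then show ?thesis unfolding R(3) using card_sym_diff_full4[OF n g(3,1,2)] 4 by blast
    next
      case 5
      then have "card ?R \<in> {3..4}" using d by (intro card_sym_diff_subsingleton4)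
      then show ?thesis using n by auto
    qed
  qed
  moreover have "card ?R \<le> 2 \<or> n - 1 \<le> card ?R"
    unfolding eq using card_gens_sym_diff[OF n2 u] .
  ultimately show False using n by auto
qed

section \<open>Closed neighbourhoods as translates of the generators\<close>

definition nbhd :: "nat \<Rightarrow> bool list \<Rightarrow> bool list set" where
  "nbhd n v = {w \<in> binary_strings n. differing n v w \<in> gens n}"

lemma differing_triangle: "differing n u w = sym_diff (differing n u v) (differing n v w)"
  by (auto simp: differing_def)

lemma differing_eq_empty_iff:
  "u \<in> binary_strings n \<Longrightarrow> v \<in> binary_strings n \<Longrightarrow> differing n u v = {} \<longleftrightarrow> u = v"
  by (auto simp: differing_def binary_strings_def list_eq_iff_nth_eq)

lemma bij_betw_differing:
  assumes "v \<in> binary_strings n"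
  shows "bij_betw (differing n v) (binary_strings n) (Pow {..<n})"
proof (rule bij_betw_imageI)
  show "inj_on (differing n v) (binary_strings n)"
  proof (rule inj_onI)
    fix x y assume xy: "x \<in> binary_strings n" "y \<in> binary_strings n" "differing n v x = differing n v y"
    then have "differing n x y = {}"
      unfolding differing_triangle[of n x y v] differing_sym[of n x v] by simp
    then show "x = y" using differing_eq_empty_iff xy by blast
  qed
  show "differing n v ` binary_strings n = Pow {..<n}"
  proof (intro equalityI subsetI)
    fix X assume X: "X \<in> Pow {..<n}"
    let ?w = "map (\<lambda>i. v ! i \<noteq> (i \<in> X)) [0..<n]"
    have "differing n v ?w = X" using X by (auto simp: differing_def)
    moreover have "?w \<in> binary_strings n" by (simp add: binary_strings_def)
    ultimately show "X \<in> differing n v ` binary_strings n" by blast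
  qed (auto simp: differing_def)
qed

lemma card_gens: "n \<ge> 2 \<Longrightarrow> card (gens n) = n + 2"
proof -
  assume n: "n \<ge> 2"
  have eq: "gens n = insert {..<n} (insert {} ((\<lambda>i. {i}) ` {..<n}))"
  proof (intro equalityI subsetI)
    fix X assume "X \<in> gens n"
    then show "X \<in> insert {..<n} (insert {} ((\<lambda>i. {i}) ` {..<n}))"
      using gens_cases[OF n, of X] by (auto simp: subsingleton_def)
  qed (auto simp: gens_def)
  have "card X \<le> 1" if "X \<in> insert {} ((\<lambda>i. {i}) ` {..<n})" for X
    using that by auto
  from this[of "{..<n}"] have "{..<n} \<notin> insert {} ((\<lambda>i. {i}) ` {..<n})" using n by auto
  then have "card (gens n) = Suc (card (insert {} ((\<lambda>i. {i}) ` {..<n})))"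
    unfolding eq by (intro card_insert_disjoint) auto
  moreover have "card ((\<lambda>i. {i}) ` {..<n}) = n" by (simp add: card_image)
  moreover have "{} \<notin> (\<lambda>i. {i}) ` {..<n}" by auto
  ultimately show ?thesis by simp
qed

lemma card_nbhd:
  assumes "n \<ge> 2" "v \<in> binary_strings n" shows "card (nbhd n v) = n + 2"
proof -
  have "differing n v ` nbhd n v = gens n"
  proof (intro equalityI subsetI)
    fix X assume X: "X \<in> gens n"
    then have "X \<in> differing n v ` binary_strings n"
      using bij_betw_differing[OF assms(2)] by (auto simp: bij_betw_def gens_def)
    then show "X \<in> differing n v ` nbhd n v" using X by (auto simp: nbhd_def)
  qed (auto simp: nbhd_def)
  moreover have "inj_on (differing n v) (nbhd n v)"
    using bij_betw_differing[OF assms(2)]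
    by (rule_tac inj_on_subset[of _ "binary_strings n"]) (auto simp: bij_betw_def nbhd_def)
  ultimately show ?thesis using card_gens[OF assms(1)] card_image by metis
qed

lemma differing_nbhd_nbhd:
  assumes "w \<in> nbhd n x" "w \<in> nbhd n y"
  obtains s t where "s \<in> gens n" "t \<in> gens n" "differing n x w = s" "differing n w y = t"
    "differing n x y = sym_diff s t"
proof
  show "differing n x w \<in> gens n" using assms(1) by (simp add: nbhd_def)
  show "differing n w y \<in> gens n" using assms(2) by (simp add: nbhd_def differing_sym[of n w y])
  show "differing n x y = sym_diff (differing n x w) (differing n w y)" by (rule differing_triangle)
qed simp_all

text \<open>A common member w writes the difference of x and y as a sum of two generators, the first
  of which determines w. By the Sidon property it is one of two.\<close>

lemma nbhd_meet_le_2: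
  assumes n: "n \<ge> 4" and xy: "x \<in> binary_strings n" "y \<in> binary_strings n" "x \<noteq> y"
  shows "card (nbhd n x \<inter> nbhd n y) \<le> 2"
proof (cases "nbhd n x \<inter> nbhd n y = {}")
  case False
  then obtain w where w: "w \<in> nbhd n x" "w \<in> nbhd n y" by auto
  obtain s t where st: "s \<in> gens n" "t \<in> gens n" "differing n x y = sym_diff s t"
    using differing_nbhd_nbhd[OF w] by metis
  have "s \<noteq> t" using st(3) differing_eq_empty_iff[OF xy(1,2)] xy(3) by auto
  have "differing n x ` (nbhd n x \<inter> nbhd n y) \<subseteq> {s, t}"
  proof (rule image_subsetI)
    fix w' assume "w' \<in> nbhd n x \<inter> nbhd n y"
    then have w': "w' \<in> nbhd n x" "w' \<in> nbhd n y" by auto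
    obtain s' t' where "s' \<in> gens n" "t' \<in> gens n" "differing n x w' = s'"
      "differing n x y = sym_diff s' t'"
      using differing_nbhd_nbhd[OF w'] by metis
    then show "differing n x w' \<in> {s, t}"
      using gens_sidon[OF n st(1,2) _ _ \<open>s \<noteq> t\<close>] st(3) by (metis insert_iff)
  qed
  moreover have "inj_on (differing n x) (nbhd n x \<inter> nbhd n y)"
    using bij_betw_differing[OF xy(1)]
    by (rule_tac inj_on_subset[of _ "binary_strings n"]) (auto simp: bij_betw_def nbhd_def)
  ultimately have "card (nbhd n x \<inter> nbhd n y) \<le> card {s, t}"
    by (intro card_inj_on_le) auto
  also have "\<dots> \<le> 2" by (simp add: card_insert_if)
  finally show ?thesis .
qed simp

lemma sym_diff_cancel: "r \<in> {s, t} \<Longrightarrow> sym_diff (sym_diff s t) r \<in> {s, t}"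
proof -
  have "sym_diff (sym_diff s t) s = t" "sym_diff (sym_diff s t) t = s" by blast+
  then show "r \<in> {s, t} \<Longrightarrow> ?thesis" by (metis insertE insertI1 insertI2 singletonD)
qed

text \<open>The differences of y and z from x are sums of two generators, and so is their sum, the
  difference of y and z. By \<open>gens_helly\<close> the two representations share a generator r,
  and moving from x by r reaches a point of all three neighbourhoods.\<close>

lemma nbhd_helly:
  assumes n: "n \<ge> 6" and xyz: "x \<in> binary_strings n" "y \<in> binary_strings n" "z \<in> binary_strings n"
    and ne: "x \<noteq> y" "x \<noteq> z"
    and meet: "nbhd n x \<inter> nbhd n y \<noteq> {}" "nbhd n y \<inter> nbhd n z \<noteq> {}" "nbhd n x \<inter> nbhd n z \<noteq> {}"
  shows "nbhd n x \<inter> nbhd n y \<inter> nbhd n z \<noteq> {}"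
proof -
  obtain s t where st: "s \<in> gens n" "t \<in> gens n" "differing n x y = sym_diff s t"
    using meet(1) differing_nbhd_nbhd by (metis disjoint_iff)
  obtain s' t' where st': "s' \<in> gens n" "t' \<in> gens n" "differing n x z = sym_diff s' t'"
    using meet(3) differing_nbhd_nbhd by (metis disjoint_iff)
  obtain u u' where u: "u \<in> gens n" "u' \<in> gens n" "differing n y z = sym_diff u u'"
    using meet(2) differing_nbhd_nbhd by (metis disjoint_iff)
  have ne': "s \<noteq> t" "s' \<noteq> t'"
    using st(3) st'(3) differing_eq_empty_iff xyz ne by auto
  have "sym_diff (sym_diff s t) (sym_diff s' t') = sym_diff u u'"
    using differing_triangle[of n y z x] unfolding differing_sym[of n y x] st(3) st'(3) u(3) by (rule sym)
  then obtain r where r: "r \<in> {s, t}" "r \<in> {s', t'}"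
    using gens_helly[OF n st(1,2) st'(1,2) u(1,2) ne'] by blast
  have "r \<in> gens n" using r(1) st(1,2) by blast
  then have "r \<in> differing n x ` binary_strings n"
    unfolding bij_betw_imp_surj_on[OF bij_betw_differing[OF xyz(1)]] by (simp add: gens_def)
  then obtain w where w: "w \<in> binary_strings n" "differing n x w = r" by blast
  have "differing n y w = sym_diff (sym_diff s t) r"
    using differing_triangle[of n y w x] unfolding differing_sym[of n y x] st(3) w(2) .
  then have y: "differing n y w \<in> gens n"
    using sym_diff_cancel[OF r(1)] st(1,2) by (metis insertE singletonD)
  have "differing n z w = sym_diff (sym_diff s' t') r"
    using differing_triangle[of n z w x] unfolding differing_sym[of n z x] st'(3) w(2) .
  then have "differing n z w \<in> gens n"
    using sym_diff_cancel[OF r(2)] st'(1,2) by (metis insertE singletonD)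
  with y have "w \<in> nbhd n x \<inter> nbhd n y \<inter> nbhd n z"
    using w \<open>r \<in> gens n\<close> by (simp add: nbhd_def)
  then show ?thesis by blast
qed

lemma helly_family_nbhd:
  assumes "n \<ge> 6" "A \<subseteq> binary_strings n"
  shows "helly_family A (nbhd n)"
proof
  show "finite A" by (rule finite_subset[OF assms(2)]) simp
  show "finite (nbhd n v)" for v by (simp add: nbhd_def)
  show "card (nbhd n x \<inter> nbhd n y) \<le> 2" if "x \<in> A" "y \<in> A" "x \<noteq> y" for x y
    using that assms by (intro nbhd_meet_le_2) auto
  show "nbhd n x \<inter> nbhd n y \<inter> nbhd n z \<noteq> {}"
    if "x \<in> A" "y \<in> A" "z \<in> A" "x \<noteq> y" "y \<noteq> z" "x \<noteq> z"
      "nbhd n x \<inter> nbhd n y \<noteq> {}" "nbhd n y \<inter> nbhd n z \<noteq> {}" "nbhd n x \<inter> nbhd n z \<noteq> {}" for x y z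
    using that assms by (intro nbhd_helly) auto
qed

section \<open>Cut bounds in the folded hypercube\<close>

lemma pverts_folded_hypercube [simp]: "pverts (folded_hypercube n) = binary_strings n"
  by (simp add: folded_hypercube_def hypercube_def)

lemma bit_complement_eq_iff:
  assumes "u \<in> binary_strings n" "v \<in> binary_strings n"
  shows "v = bit_complement u \<longleftrightarrow> differing n u v = {..<n}"
  using assms by (auto simp: binary_strings_def bit_complement_def differing_def list_eq_iff_nth_eq)

lemma parcs_folded_hypercube_iff:
  assumes "n \<ge> 1"
  shows "(u, v) \<in> parcs (folded_hypercube n) \<longleftrightarrow> u \<in> binary_strings n \<and> v \<in> nbhd n u \<and> v \<noteq> u"
proof (cases "u \<in> binary_strings n \<and> v \<in> binary_strings n")
  case True
  have gens: "card X = 1 \<or> X = {..<n} \<longleftrightarrow> X \<in> gens n \<and> X \<noteq> {}" if "X \<subseteq> {..<n}" for X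
  proof -
    have "card X = 1 \<longleftrightarrow> card X \<le> 1 \<and> X \<noteq> {}"
      using that finite_subset[OF that] by (auto simp: le_Suc_eq)
    moreover have "{..<n} \<noteq> {}" using assms by (auto simp: lessThan_empty_iff)
    ultimately show ?thesis using that unfolding gens_def by blast
  qed
  have "(u, v) \<in> parcs (folded_hypercube n) \<longleftrightarrow> card (differing n u v) = 1 \<or> differing n u v = {..<n}"
    using True bit_complement_eq_iff[of u n v]
    by (auto simp: folded_hypercube_def hypercube_def differing_def)
  also have "\<dots> \<longleftrightarrow> differing n u v \<in> gens n \<and> differing n u v \<noteq> {}"
    by (rule gens) (auto simp: differing_def)
  also have "\<dots> \<longleftrightarrow> v \<in> nbhd n u \<and> v \<noteq> u"
    using True differing_eq_empty_iff[of u n v] by (auto simp: nbhd_def)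
  finally show ?thesis using True by simp
next
  case False
  have "bit_complement u \<in> binary_strings n \<longleftrightarrow> u \<in> binary_strings n"
    by (simp add: binary_strings_def bit_complement_def)
  then show ?thesis using False by (auto simp: folded_hypercube_def hypercube_def nbhd_def)
qed

text \<open>The quadratic is symmetric about n + 1/2 and concave, so its value at n + 2 equals that
  at n - 1 and it is smallest at g on the range from g to n + 2. This fixes the border between small
  and large sides.\<close>

lemma cut_bound_mono:
  fixes a g n :: int
  assumes "g \<le> a" "a \<le> n + 2" "g \<le> n - 1"
  shows "2 * g * (n + 1) - g * (g + 1) \<le> 2 * a * (n + 1) - a * (a + 1)"
proof -
  have "(a - g) * (2 * (n + 1) - a - g - 1) \<ge> 0" using assms by (intro mult_nonneg_nonneg) auto
  then show ?thesis by (simp add: algebra_simps)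
qed

text \<open>The closed neighbourhood of \<open>A\<close> avoids \<open>B\<close>, so all of it
  except \<open>A\<close> lies in the cut; subtracting \<open>card A\<close> turns the factor n + 2
  of the union bound into n + 1.\<close>

lemma folded_hypercube_small_bound:
  assumes n: "n \<ge> 6" and A: "A \<subseteq> binary_strings n" "A \<noteq> {}" and B: "B \<subseteq> binary_strings n"
    and nonadj: "\<And>x. x \<in> A \<Longrightarrow> nbhd n x \<inter> B = {}"
  shows "2 * int (card A) * (int n + 1) - int (card A) * (int (card A) + 1) + 2 \<le> 2 * cut_size n A B"
proof -
  let ?U = "\<Union> (nbhd n ` A)"
  have "finite ?U" "finite B" using A B finite_subset[OF _ finite_binary_strings[of n]]
    by (auto simp: nbhd_def)
  then have "card (?U \<union> B) = card ?U + card B"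
    using nonadj by (intro card_Un_disjoint) auto
  moreover have "card (?U \<union> B) \<le> card (binary_strings n)"
    using B by (intro card_mono) (auto simp: nbhd_def)
  ultimately have "card ?U + card B \<le> 2 ^ n" by (simp add: card_binary_strings)
  then have "int (card ?U) + int (card B) \<le> 2 ^ n"
    by (metis of_nat_add of_nat_le_iff of_nat_numeral of_nat_power)
  moreover have "2 * int (card A) * int (n + 2) - int (card A) * (int (card A) + 1) + 2 \<le> 2 * int (card ?U)"
    using A n by (intro helly_family_card_Union helly_family_nbhd card_nbhd) auto
  ultimately show ?thesis by (simp add: cut_size_def algebra_simps)
qed

lemma folded_hypercube_cut_bound:
  assumes n: "n \<ge> 8" and g: "1 \<le> g" "g \<le> n - 1"
    and A: "A \<subseteq> binary_strings n" "g \<le> card A" and B: "B \<subseteq> binary_strings n" "g \<le> card B"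
    and nonadj: "\<And>x. x \<in> A \<Longrightarrow> nbhd n x \<inter> B = {}"
  shows "2 * int g * (int n + 1) - int g * (int g + 1) + 2 \<le> 2 * cut_size n A B"
proof -
  have nonadj': "nbhd n y \<inter> A = {}" if "y \<in> B" for y
    using that nonadj differing_sym A B by (fastforce simp: nbhd_def)
  consider "card A \<le> n + 2" | "card B \<le> n + 2" | "card A \<ge> n + 3" "card B \<ge> n + 3" by linarith
  then show ?thesis
  proof cases
    case 1
    have "2 * int (card A) * (int n + 1) - int (card A) * (int (card A) + 1) + 2 \<le> 2 * cut_size n A B"
      using n A B g nonadj by (intro folded_hypercube_small_bound) auto
    moreover have "2 * int g * (int n + 1) - int g * (int g + 1)
        \<le> 2 * int (card A) * (int n + 1) - int (card A) * (int (card A) + 1)"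
      using 1 A g n by (intro cut_bound_mono) auto
    ultimately show ?thesis by linarith
  next
    case 2
    have "2 * int (card B) * (int n + 1) - int (card B) * (int (card B) + 1) + 2 \<le> 2 * cut_size n B A"
      using n A B g nonadj' by (intro folded_hypercube_small_bound) auto
    moreover have "2 * int g * (int n + 1) - int g * (int g + 1)
        \<le> 2 * int (card B) * (int n + 1) - int (card B) * (int (card B) + 1)"
      using 2 B g n by (intro cut_bound_mono) auto
    ultimately show ?thesis unfolding cut_size_commute[of n A B] by linarith
  next
    case 3
    have "separated n A B"
      unfolding separated_def
    proof (intro conjI ballI A B)
      fix a b assume ab: "a \<in> A" "b \<in> B"
      then have "differing n a b \<notin> gens n" using nonadj B by (auto simp: nbhd_def)
      moreover have "differing n a b \<subseteq> {..<n}" by (auto simp: differing_def)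
      ultimately show "2 \<le> card (differing n a b)" by (auto simp: gens_def)
    qed
    then have "int n * (int n + 1) \<le> 2 * cut_size n A B"
      using n 3 by (intro separated_large_bound) auto
    \<comment> \<open>At g = n - 1 the claimed value is exactly n(n + 1)/2, and it is largest
      there.\<close>
    moreover have "2 * (int n - 1) * (int n + 1) - (int n - 1) * (int n - 1 + 1) + 2 = int n * (int n + 1)"
      by (simp add: algebra_simps)
    moreover have "2 * int g * (int n + 1) - int g * (int g + 1)
        \<le> 2 * (int n - 1) * (int n + 1) - (int n - 1) * (int n - 1 + 1)"
      using g n by (intro cut_bound_mono) auto
    ultimately show ?thesis by linarith
  qed
qed

section \<open>Component cuts\<close>

text \<open>If some member has at least g elements, the others, at least g in number, contribute one
  element each. Otherwise a smallest subfamily covering at least g elements covers at most 2g, and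
  at least g of the 3g elements remain.\<close>

lemma balanced_subfamily:
  assumes fin: "finite C" "\<And>X. X \<in> C \<Longrightarrow> finite X" "\<And>X. X \<in> C \<Longrightarrow> X \<noteq> {}"
    and disj: "\<And>X Y. X \<in> C \<Longrightarrow> Y \<in> C \<Longrightarrow> X \<noteq> Y \<Longrightarrow> X \<inter> Y = {}"
    and card: "g + 1 \<le> card C" "3 * g \<le> card (\<Union> C)"
  shows "\<exists>D\<subseteq>C. g \<le> card (\<Union> D) \<and> g \<le> card (\<Union> (C - D))"
proof -
  have card_Union: "card (\<Union> D) = sum card D" if "D \<subseteq> C" for D
  proof (rule card_Union_disjoint)
    show "pairwise disjnt D"
      unfolding pairwise_def disjnt_def using that disj by (meson subsetD)
  qed (use that fin(2) in blast)
  show ?thesis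
  proof (cases "\<exists>X\<in>C. g \<le> card X")
    case True
    then obtain X where X: "X \<in> C" "g \<le> card X" by blast
    have "card (C - {X}) \<le> sum card (C - {X})"
    proof -
      have "sum (\<lambda>_. 1) (C - {X}) \<le> sum card (C - {X})"
        using fin by (intro sum_mono) (auto simp: Suc_le_eq card_gt_0_iff)
      then show ?thesis by simp
    qed
    then have "g \<le> card (\<Union> (C - {X}))" using card(1) X(1) fin(1) by (simp add: card_Union)
    then show ?thesis using X by (intro exI[of _ "{X}"]) auto
  next
    case False
    define P where "P D \<longleftrightarrow> D \<subseteq> C \<and> g \<le> card (\<Union> D)" for D
    have "P C" using card(2) by (simp add: P_def)
    then obtain D where D: "P D" and min: "\<And>E. P E \<Longrightarrow> card D \<le> card E"
      using ex_has_least_nat[of P C card] by blast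
    have finD: "finite D" using D fin(1) finite_subset by (auto simp: P_def)
    have small: "card (\<Union> D) \<le> 2 * g"
    proof (cases "D = {}")
      case False
      then obtain X where X: "X \<in> D" by blast
      have "\<not> P (D - {X})" using min[of "D - {X}"] X finD card_Diff1_less[of D X] by auto
      then have "card (\<Union> (D - {X})) < g" using D by (auto simp: P_def)
      moreover have "card (\<Union> D) = card X + card (\<Union> (D - {X}))"
      proof -
        have "D \<subseteq> C" "D - {X} \<subseteq> C" using D by (auto simp: P_def)
        then show ?thesis using sum.remove[OF finD X, of card] by (simp add: card_Union)
      qed
      moreover have "card X < g" using X D \<open>\<not> (\<exists>X\<in>C. g \<le> card X)\<close> by (force simp: P_def)
      ultimately show ?thesis by simp
    qed simp
    have "card (\<Union> C) = card (\<Union> D) + card (\<Union> (C - D))"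
      using D fin(1) card_Union[of C] card_Union[of D] card_Union[of "C - D"]
        sum.subset_diff[of D C card] by (auto simp: P_def)
    then show ?thesis using small card(2) D by (intro exI[of _ D]) (auto simp: P_def)
  qed
qed

text \<open>Components are sorted into two groups. No arc joins distinct components, since its
  reverse would make the ends mutually reachable.\<close>

lemma cut_two_sides:
  assumes "pair_graph G" and cut: "component_cut G (g + 1) S" and big: "3 * g \<le> card (pverts G - S)"
  obtains A B where "A \<union> B = pverts G - S" "A \<inter> B = {}" "g \<le> card A" "g \<le> card B"
    "\<And>x y. x \<in> A \<Longrightarrow> y \<in> B \<Longrightarrow> (x, y) \<notin> parcs G"
proof -
  interpret G: pair_graph G by fact
  define W where "W = pverts G - S"
  define H where "H = with_proj G \<restriction> W"
  interpret H: wf_digraph H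
    unfolding H_def by unfold_locales auto
  have ends: "arcs_ends H = {(u, v). (u, v) \<in> parcs G \<and> u \<in> W \<and> v \<in> W}"
    by (auto simp: H_def arcs_ends_def arc_to_ends_def)
  have verts: "verts H = W" by (simp add: H_def)
  have Un: "\<Union> H.sccs_verts = W"
    using H.sccs_verts_subsets H.scc_of_in_sccs_verts H.in_scc_of_self by (fastforce simp: verts)
  have finW: "finite W" by (simp add: W_def)
  have finC: "finite H.sccs_verts"
    using finite_UnionD[of H.sccs_verts] finW Un by simp
  have card_ge: "g + 1 \<le> card H.sccs_verts"
    using cut H.card_sccs_verts by (simp add: component_cut_def H_def W_def)
  have "\<exists>D\<subseteq>H.sccs_verts. g \<le> card (\<Union> D) \<and> g \<le> card (\<Union> (H.sccs_verts - D))"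
  proof (rule balanced_subfamily[OF finC])
    show "finite X" if "X \<in> H.sccs_verts" for X
      using H.sccs_verts_subsets[OF that] finW finite_subset by (auto simp: verts)
    show "X \<noteq> {}" if "X \<in> H.sccs_verts" for X
      using that by (simp add: H.in_sccs_verts_conv_reachable)
    show "X \<inter> Y = {}" if "X \<in> H.sccs_verts" "Y \<in> H.sccs_verts" "X \<noteq> Y" for X Y
      using that by (rule H.sccs_verts_disjoint)
    show "3 * g \<le> card (\<Union> H.sccs_verts)" using big by (simp add: Un W_def)
  qed (rule card_ge)
  then obtain D where D: "D \<subseteq> H.sccs_verts" "g \<le> card (\<Union> D)" "g \<le> card (\<Union> (H.sccs_verts - D))"
    by blast
  show ?thesis
  proof (rule that)
    show "\<Union> D \<union> \<Union> (H.sccs_verts - D) = pverts G - S" using D(1) Un unfolding W_def by blast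
    show "\<Union> D \<inter> \<Union> (H.sccs_verts - D) = {}" using D(1) H.sccs_verts_disjoint by blast
    fix x y assume xy: "x \<in> \<Union> D" "y \<in> \<Union> (H.sccs_verts - D)"
    then obtain X Y where XY: "x \<in> X" "X \<in> D" "y \<in> Y" "Y \<in> H.sccs_verts" "Y \<notin> D" by blast
    have X: "X \<in> H.sccs_verts" using XY D(1) by blast
    then have "y \<notin> X" using XY H.sccs_verts_disjoint[of X Y] by blast
    then have not: "\<not> (x \<rightarrow>\<^sup>*\<^bsub>H\<^esub> y \<and> y \<rightarrow>\<^sup>*\<^bsub>H\<^esub> x)"
      using X XY(1) unfolding H.in_sccs_verts_conv_reachable by blast
    have "x \<in> W" "y \<in> W" using XY X Un by blast+
    show "(x, y) \<notin> parcs G"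
    proof
      assume "(x, y) \<in> parcs G"
      moreover from this have "(y, x) \<in> parcs G"
        using G.graph_symmetric[of x y] by simp
      ultimately have "x \<rightarrow>\<^bsub>H\<^esub> y" "y \<rightarrow>\<^bsub>H\<^esub> x" using \<open>x \<in> W\<close> \<open>y \<in> W\<close> by (auto simp: ends)
      then show False using not by blast
    qed
  qed (use D in auto)
qed

text \<open>Every vertex of \<open>A\<close> becomes a component of its own, and the component of
  \<open>z\<close> is one more.\<close>

lemma component_cutI:
  assumes "pair_graph G" and S: "S \<subseteq> pverts G" and A: "A \<subseteq> pverts G - S" "g \<le> card A"
    and isolated: "\<And>x y. x \<in> A \<Longrightarrow> (x, y) \<in> parcs G \<Longrightarrow> y \<in> S"
    and z: "z \<in> pverts G - S" "z \<notin> A"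
  shows "component_cut G (g + 1) S"
proof -
  interpret G: pair_graph G by fact
  define W where "W = pverts G - S"
  define H where "H = with_proj G \<restriction> W"
  interpret H: wf_digraph H
    unfolding H_def by unfold_locales auto
  have ends: "arcs_ends H = {(u, v). (u, v) \<in> parcs G \<and> u \<in> W \<and> v \<in> W}"
    by (auto simp: H_def arcs_ends_def arc_to_ends_def)
  have verts: "verts H = W" by (simp add: H_def)
  have scc: "H.scc_of x = {x}" if "x \<in> A" for x
  proof -
    have "y = x" if "x \<rightarrow>\<^sup>*\<^bsub>H\<^esub> y" for y
      using that by (cases rule: H.converse_reachable_cases)
        (use \<open>x \<in> A\<close> isolated in \<open>auto simp: ends W_def\<close>)
    then show ?thesis using H.in_scc_of_self[of x] that A(1) by (auto simp: H.scc_of_def verts W_def)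
  qed
  have finA: "finite A" using A(1) by (auto intro: finite_subset)
  have "insert (H.scc_of z) ((\<lambda>x. {x}) ` A) \<subseteq> H.sccs_verts"
  proof -
    have "H.scc_of x \<in> H.sccs_verts" if "x \<in> W" for x
      using that by (intro H.scc_of_in_sccs_verts) (simp add: verts)
    then show ?thesis using scc A(1) z(1) by (force simp: W_def)
  qed
  moreover have "finite H.sccs_verts"
    using finite_UnionD[of H.sccs_verts] finite_subset[of "\<Union> H.sccs_verts" W] H.sccs_verts_subsets
    by (force simp: verts W_def)
  ultimately have "card (insert (H.scc_of z) ((\<lambda>x. {x}) ` A)) \<le> card H.sccs_verts"
    by (intro card_mono)
  moreover have "H.scc_of z \<notin> (\<lambda>x. {x}) ` A"
    using H.in_scc_of_self[of z] z by (auto simp: verts W_def)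
  ultimately have "g + 1 \<le> card H.sccs_verts"
    using A(2) finA by (simp add: card_image)
  then show ?thesis using S H.card_sccs_verts by (simp add: component_cut_def H_def W_def)
qed

lemma folded_hypercube_lower_bound:
  assumes n: "n \<ge> 8" and g: "1 \<le> g" "g \<le> n - 1"
    and cut: "component_cut (folded_hypercube n) (g + 1) S"
  shows "2 * int g * (int n + 1) - int g * (int g + 1) + 2 \<le> 2 * int (card S)"
proof -
  let ?W = "binary_strings n - S"
  have S: "S \<subseteq> binary_strings n" using cut by (simp add: component_cut_def)
  have "finite S" using S finite_subset by (metis finite_binary_strings)
  then have "card ?W = 2 ^ n - card S" "card S \<le> 2 ^ n"
    using card_Diff_subset[OF _ S] card_mono[OF finite_binary_strings S]
    by (auto simp: card_binary_strings)
  then have cW: "int (card ?W) = 2 ^ n - int (card S)" by (simp add: of_nat_diff)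
  show ?thesis
  proof (cases "3 * g \<le> card ?W")
    case True
    have G: "pair_graph (folded_hypercube n)" using n by (intro pair_graph_folded_hypercube) simp
    obtain A B where AB: "A \<union> B = ?W" "A \<inter> B = {}" "g \<le> card A" "g \<le> card B"
      and na: "\<And>x y. x \<in> A \<Longrightarrow> y \<in> B \<Longrightarrow> (x, y) \<notin> parcs (folded_hypercube n)"
      using cut_two_sides[OF G cut] True by (metis pverts_folded_hypercube)
    have sub: "A \<subseteq> binary_strings n" "B \<subseteq> binary_strings n" using AB(1) by auto
    have "nbhd n x \<inter> B = {}" if "x \<in> A" for x
      using na[OF that] that AB(2) sub n parcs_folded_hypercube_iff[of n x] by auto
    then have "2 * int g * (int n + 1) - int g * (int g + 1) + 2 \<le> 2 * cut_size n A B"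
      using n g AB sub by (intro folded_hypercube_cut_bound) auto
    moreover have "card ?W = card A + card B"
      using AB sub finite_subset[OF _ finite_binary_strings[of n]] by (metis card_Un_disjoint)
    ultimately show ?thesis using cW by (simp add: cut_size_def)
  next
    \<comment> \<open>With fewer than 3g vertices left, the cut is nearly the whole cube and exceeds
      the quadratic bound.\<close>
    case False
    have "2 * int g * (int n + 1) - int g * (int g + 1)
        \<le> 2 * (int n - 1) * (int n + 1) - (int n - 1) * (int n - 1 + 1)"
      using g n by (intro cut_bound_mono) auto
    also have "\<dots> = int n * (int n - 1) + 2 * int n - 2" by (simp add: algebra_simps)
    also have "\<dots> \<le> 2 * 2 ^ n - 6 * int g - 2"
      using power2_ge[of n] n g by simp
    also have "\<dots> \<le> 2 * int (card S) - 2" using cW False by simp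
    finally show ?thesis by simp
  qed
qed

section \<open>A cut attaining the bound\<close>

text \<open>
  The open neighbourhood of the vertices \<open>{i}\<close> with \<open>i < g\<close>.
\<close>

definition star_cut :: "nat \<Rightarrow> nat \<Rightarrow> nat set set" where
  "star_cut n g = insert {} ((\<lambda>i. {..<n} - {i}) ` {..<g} \<union>
     (\<lambda>(i, j). {i, j}) ` (SIGMA i : {..<g}. {i<..<n}))"

text \<open>The terms count the centre, the g complements of singletons, and for each i < g the n -
  1 - i pairs with smaller element i.\<close>

lemma card_star_cut:
  assumes "g \<le> n"
  shows "2 * int (card (star_cut n g)) \<le> 2 * int g * (int n + 1) - int g * (int g + 1) + 2"
proof -
  have sum: "2 * int (\<Sum>i<g. n - Suc i) = 2 * int g * int n - int g * (int g + 1)"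
    using assms by (induction g) (auto simp: algebra_simps of_nat_diff)
  have "card (star_cut n g) \<le> Suc (card ((\<lambda>i. {..<n} - {i}) ` {..<g} \<union>
     (\<lambda>(i, j). {i, j}) ` (SIGMA i : {..<g}. {i<..<n})))"
    unfolding star_cut_def by (simp add: card_insert_if)
  also have "\<dots> \<le> Suc (card ((\<lambda>i. {..<n} - {i}) ` {..<g}) +
     card ((\<lambda>(i, j). {i, j}) ` (SIGMA i : {..<g}. {i<..<n})))"
    by (simp add: card_Un_le)
  also have "\<dots> \<le> Suc (card {..<g} + card (SIGMA i : {..<g}. {i<..<n}))"
    by (intro Suc_le_mono[THEN iffD2] add_mono card_image_le) auto
  also have "\<dots> = Suc (g + (\<Sum>i<g. n - Suc i))" by simp
  finally have "2 * int (card (star_cut n g)) \<le> 2 + 2 * int g + 2 * int (\<Sum>i<g. n - Suc i)" by linarith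
  then show ?thesis unfolding sum by (simp add: algebra_simps)
qed

lemma sym_diff_singleton_gens:
  assumes "n \<ge> 2" "i < g" "g \<le> n" "X \<subseteq> {..<n}" "sym_diff {i} X \<in> gens n" "X \<noteq> {i}"
  shows "X \<in> star_cut n g"
proof -
  have X: "X = sym_diff {i} (sym_diff {i} X)" by auto
  consider "sym_diff {i} X = {..<n}" | "sym_diff {i} X = {}" | j where "sym_diff {i} X = {j}" "j < n"
    using gens_cases[OF assms(1,5)] by (auto simp: subsingleton_def)
  then show ?thesis
  proof cases
    case 1
    then have "X = {..<n} - {i}" using X assms by auto
    then show ?thesis using assms(2) by (auto simp: star_cut_def)
  next
    case 2
    then show ?thesis using X assms(6) by auto
  next
    case (3 j)
    show ?thesis
    proof (cases "j = i")
      case True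
      then have "X = {}" using X 3 by auto
      then show ?thesis by (simp add: star_cut_def)
    next
      case False
      then have X': "X = {min i j, max i j}" using X 3 by (auto simp: min_def max_def)
      \<comment> \<open>The pair is indexed by its smaller element, which is at most i and hence
        below g.\<close>
      have "(min i j, max i j) \<in> (SIGMA i : {..<g}. {i<..<n})" using False 3(2) assms by auto
      then show ?thesis unfolding star_cut_def X' by force
    qed
  qed
qed

lemma star_cut_subset: "g \<le> n \<Longrightarrow> star_cut n g \<subseteq> Pow {..<n}"
  by (auto simp: star_cut_def)

lemma folded_hypercube_upper_bound:
  assumes n: "n \<ge> 8" and g: "1 \<le> g" "g \<le> n - 1"
  shows "\<exists>S. component_cut (folded_hypercube n) (g + 1) S \<and>
    2 * int (card S) \<le> 2 * int g * (int n + 1) - int g * (int g + 1) + 2"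
proof -
  define c where "c = replicate n False"
  have c: "c \<in> binary_strings n" by (simp add: c_def binary_strings_def)
  have bij: "bij_betw (differing n c) (binary_strings n) (Pow {..<n})" by (rule bij_betw_differing[OF c])
  define f where "f = the_inv_into (binary_strings n) (differing n c)"
  have f: "f X \<in> binary_strings n" "differing n c (f X) = X" if "X \<subseteq> {..<n}" for X
    using that bij f_the_inv_into_f_bij_betw[OF bij, of X] unfolding f_def
    by (auto simp: bij_betw_def intro: the_inv_into_into)
  have f_eq: "x = f (differing n c x)" if "x \<in> binary_strings n" for x
    using that bij unfolding f_def bij_betw_def by (simp add: the_inv_into_f_f)
  have inj: "inj_on f (Pow {..<n})" by (rule inj_on_inverseI[of _ "differing n c"]) (use f in auto)
  have sub: "star_cut n g \<subseteq> Pow {..<n}" using g by (intro star_cut_subset) auto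
  \<comment> \<open>No singleton belongs to the cut, so the g vertices to be isolated survive the
    deletion.\<close>
  have two: "card X \<noteq> 1" if "X \<in> star_cut n g" for X
    using that n g by (auto simp: star_cut_def card_Diff_singleton_if split: if_splits)
  let ?S = "f ` star_cut n g" and ?A = "(\<lambda>i. f {i}) ` {..<g}"
  have bound: "2 * int (card (star_cut n g)) \<le> 2 * int g * (int n + 1) - int g * (int g + 1) + 2"
    using g by (intro card_star_cut) auto
  have cS: "card ?S \<le> card (star_cut n g)"
    using sub finite_subset by (intro card_image_le) blast
  have A: "?A \<subseteq> binary_strings n - ?S"
  proof
    fix x assume "x \<in> ?A"
    then obtain i where i: "i < g" "x = f {i}" by auto
    then have "{i} \<subseteq> {..<n}" using g by auto
    moreover have "{i} \<notin> star_cut n g" using two by force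
    moreover have "f {i} \<notin> ?S" if "{i} \<subseteq> {..<n}" "{i} \<notin> star_cut n g"
      using that inj_on_image_mem_iff[OF inj _ sub, of "{i}"] by blast
    ultimately show "x \<in> binary_strings n - ?S" using f(1)[of "{i}"] i(2) by simp
  qed
  have "card ?A = g"
  proof -
    have "inj_on (\<lambda>i. f {i}) {..<g}"
    proof (rule inj_onI)
      fix i j assume ij: "i \<in> {..<g}" "j \<in> {..<g}" and eq: "f {i} = f {j}"
      have "{i} \<subseteq> {..<n}" "{j} \<subseteq> {..<n}" using ij g by auto
      from f(2)[OF this(1)] f(2)[OF this(2)] have "{i} = {j}" unfolding eq by simp
      then show "i = j" by simp
    qed
    then show ?thesis by (simp add: card_image)
  qed
  have "component_cut (folded_hypercube n) (g + 1) ?S"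
  proof -
    \<comment> \<open>Counting provides a vertex outside the cut and the isolated vertices; it lies
      in one further component.\<close>
    have "card (?S \<union> ?A) < card (binary_strings n)"
    proof -
      have "int (card (?S \<union> ?A)) \<le> int (card (star_cut n g)) + int g"
        using card_Un_le[of ?S ?A] cS \<open>card ?A = g\<close> by simp
      moreover have "2 * int g * (int n + 1) - int g * (int g + 1)
          \<le> 2 * (int n - 1) * (int n + 1) - (int n - 1) * (int n - 1 + 1)"
        using g n by (intro cut_bound_mono) auto
      moreover have "2 * (int n - 1) * (int n + 1) - (int n - 1) * (int n - 1 + 1)
          = int n * (int n - 1) + 2 * int n - 2" by (simp add: algebra_simps)
      ultimately have "2 * int (card (?S \<union> ?A)) \<le> int n * (int n - 1) + 2 * int n + 2 * int g"
        using bound by linarith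
      also have "\<dots> < 2 * 2 ^ n" using power2_ge[of n] n g by simp
      finally have "int (card (?S \<union> ?A)) < int (2 ^ n)" by simp
      then show ?thesis by (simp only: card_binary_strings of_nat_less_iff)
    qed
    moreover have "finite (?S \<union> ?A)" using sub finite_subset by blast
    ultimately have "\<not> binary_strings n \<subseteq> ?S \<union> ?A" using card_mono leD by blast
    then obtain z where z: "z \<in> binary_strings n - ?S" "z \<notin> ?A" by blast
    show ?thesis
    proof (rule component_cutI[where A = ?A and z = z])
      show "pair_graph (folded_hypercube n)" using n by (intro pair_graph_folded_hypercube) simp
      fix x y assume "x \<in> ?A" and xy: "(x, y) \<in> parcs (folded_hypercube n)"
      then obtain i where i: "i < g" "x = f {i}" by auto
      have iN: "{i} \<subseteq> {..<n}" using i g by auto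
      have y: "y \<in> binary_strings n" "differing n x y \<in> gens n" "y \<noteq> x"
        using xy n by (auto simp: parcs_folded_hypercube_iff nbhd_def)
      have "differing n x y = sym_diff (differing n c x) (differing n c y)"
        using differing_triangle[of n x y c] unfolding differing_sym[of n x c] .
      then have "sym_diff {i} (differing n c y) \<in> gens n"
        using y(2) f(2)[OF iN] i(2) by simp
      moreover have "differing n c y \<noteq> {i}" using y f_eq[OF y(1)] i(2) by auto
      ultimately have "differing n c y \<in> star_cut n g"
        using n g i by (intro sym_diff_singleton_gens[of n i]) (auto simp: differing_def)
      then show "y \<in> ?S" using f_eq[OF y(1)] by blast
    qed (use A z sub f \<open>card ?A = g\<close> in auto)
  qed
  then show ?thesis using cS bound by (intro exI[of _ ?S]) auto
qed

theorem theorem2p11: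
  fixes n g :: nat
  assumes "n \<ge> 8" and "1 \<le> g" and "g \<le> n - 1"
  shows "real (component_connectivity (g + 1) (folded_hypercube n))
           = real g * (real n + 1) - 1 / 2 * real g * (real g + 1) + 1"
proof -
  let ?G = "folded_hypercube n" and ?F = "2 * int g * (int n + 1) - int g * (int g + 1) + 2"
  obtain S where S: "component_cut ?G (g + 1) S" "2 * int (card S) \<le> ?F"
    using folded_hypercube_upper_bound[OF assms] by blast
  have lower: "?F \<le> 2 * int (card T)" if "component_cut ?G (g + 1) T" for T
    using folded_hypercube_lower_bound[OF assms that] .
  have "component_connectivity (g + 1) ?G = card S"
    unfolding component_connectivity_def
  proof (rule Least_equality)
    show "\<exists>T. component_cut ?G (g + 1) T \<and> card T = card S" using S by blast
    show "card S \<le> s" if "\<exists>T. component_cut ?G (g + 1) T \<and> card T = s" for s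
      using that S lower by fastforce
  qed
  moreover have "2 * int (card S) = ?F" using S lower[OF S(1)] by simp
  then have "real_of_int (2 * int (card S)) = real_of_int ?F" by (simp only:)
  then have "2 * real (card S) = 2 * real g * (real n + 1) - real g * (real g + 1) + 2"
    by simp
  ultimately show ?thesis by (simp add: field_simps)
qed

end
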